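(* Any two quasipositive factorizations of a BKL-positive braid $X\in\mathbf{B}_3$ are Hurwitz equivalent.
   Context: $\mathbf{B}_3=\langle\sigma_1,\sigma_2\mid\sigma_1\sigma_2\sigma_1=\sigma_2\sigma_1\sigma_2\rangle$ is the group of braids with three strings, and $\sigma_0=\sigma_1^{-1}\sigma_2\sigma_1$. A braid in $\mathbf{B}_3$ is BKL-positive if it is represented by a word over the alphabet $\{\sigma_0,\sigma_1,\sigma_2\}$ (no inverses). A quasipositive factorization of $X\in\mathbf{B}_3$ is a tuple $(X_1,\dots,X_k)\in\mathbf{B}_3^k$ such that $X_1\cdots X_k=X$ and each $X_i$ is conjugate in $\mathbf{B}_3$ to $\sigma_1$. (The length $k$ is determined by $X$.) For a group $G$ and $1\le i<k$, define $\Sigma_i:G^k\to G^k$ by $\Sigma_i(X_1,\dots,X_k)=(Y_1,\dots,Y_k)$ where $(Y_i,Y_{i+1})=(X_iX_{i+1}X_i^{-1},X_i)$ and $Y_j=X_j$ for $j\notin\{i,i+1\}$. These maps are invertible, and $\sigma_i\mapsto\Sigma_i$ defines an action of the braid group $\mathbf{B}_k$ on $G^k$, called the Hurwitz action. Two tuples in $\mathbf{B}_3^k$ are Hurwitz equivalent if they lie in the same orbit of this action (with $G=\mathbf{B}_3$). *)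

theory Defs
  imports "HOL-Algebra.Group_Action"
begin

section \<open>Braid groups\<close>

text \<open>
  The braid group on \<open>n\<close> strings, with generators \<open>1, \<dots>, n - 1\<close>, is the set of words
  in the generators and their formal inverses modulo the congruence generated by the
  free cancellations and the Artin relations.
\<close>

datatype letter = Gen nat | Gen_inv nat

fun inv_letter :: "letter \<Rightarrow> letter" where
  "inv_letter (Gen i) = Gen_inv i"
| "inv_letter (Gen_inv i) = Gen i"

definition braid_words :: "nat \<Rightarrow> letter list set" where
  "braid_words n = lists (Gen ` {1..<n} \<union> Gen_inv ` {1..<n})"

inductive braid_equiv :: "nat \<Rightarrow> letter list \<Rightarrow> letter list \<Rightarrow> bool" for n where
  refl: "w \<in> braid_words n \<Longrightarrow> braid_equiv n w w"
| sym: "braid_equiv n u v \<Longrightarrow> braid_equiv n v u"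
| trans: "braid_equiv n u v \<Longrightarrow> braid_equiv n v w \<Longrightarrow> braid_equiv n u w"
| ctxt: "braid_equiv n u v \<Longrightarrow> p \<in> braid_words n \<Longrightarrow> q \<in> braid_words n
    \<Longrightarrow> braid_equiv n (p @ u @ q) (p @ v @ q)"
| cancel: "[l] \<in> braid_words n \<Longrightarrow> braid_equiv n [l, inv_letter l] []"
| braid: "1 \<le> i \<Longrightarrow> i + 1 < n
    \<Longrightarrow> braid_equiv n [Gen i, Gen (i + 1), Gen i] [Gen (i + 1), Gen i, Gen (i + 1)]"
| comm: "1 \<le> i \<Longrightarrow> i + 2 \<le> j \<Longrightarrow> j < n
    \<Longrightarrow> braid_equiv n [Gen i, Gen j] [Gen j, Gen i]"

definition braid_rel :: "nat \<Rightarrow> (letter list \<times> letter list) set" where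
  "braid_rel n = {(u, v). braid_equiv n u v}"

definition braid_class :: "nat \<Rightarrow> letter list \<Rightarrow> letter list set" where
  "braid_class n w = braid_rel n `` {w}"

definition braid_group :: "nat \<Rightarrow> letter list set monoid" where
  "braid_group n =
    \<lparr>carrier = braid_words n // braid_rel n,
     mult = \<lambda>A B. \<Union>u\<in>A. \<Union>v\<in>B. braid_class n (u @ v),
     one = braid_class n []\<rparr>"

lemma braid_words_Cons: "l # w \<in> braid_words n \<longleftrightarrow> [l] \<in> braid_words n \<and> w \<in> braid_words n"
  by (auto simp: braid_words_def)

lemma braid_words_simps [simp]:
  "[] \<in> braid_words n"
  "u @ v \<in> braid_words n \<longleftrightarrow> u \<in> braid_words n \<and> v \<in> braid_words n"
  "l # l' # w \<in> braid_words n \<longleftrightarrow> [l] \<in> braid_words n \<and> l' # w \<in> braid_words n"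
  "[Gen i] \<in> braid_words n \<longleftrightarrow> 1 \<le> i \<and> i < n"
  "[Gen_inv i] \<in> braid_words n \<longleftrightarrow> 1 \<le> i \<and> i < n"
  "[inv_letter l] \<in> braid_words n \<longleftrightarrow> [l] \<in> braid_words n"
  by (auto simp: braid_words_def) (cases l; auto)+

lemma braid_equiv_words:
  assumes "braid_equiv n u v"
  shows "u \<in> braid_words n" "v \<in> braid_words n"
  using assms by (induction rule: braid_equiv.induct) auto

lemma equiv_braid_rel: "equiv (braid_words n) (braid_rel n)"
  unfolding braid_rel_def
  by (rule equivI)
    (auto simp: refl_on_def sym_def trans_def dest: braid_equiv_words
      intro: braid_equiv.refl braid_equiv.sym braid_equiv.trans)

lemma braid_class_eq_iff:
  assumes "u \<in> braid_words n" "v \<in> braid_words n"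
  shows "braid_class n u = braid_class n v \<longleftrightarrow> braid_equiv n u v"
  using eq_equiv_class_iff[OF equiv_braid_rel assms]
  by (simp add: braid_class_def braid_rel_def)

lemma mem_braid_class [simp]: "v \<in> braid_class n u \<longleftrightarrow> braid_equiv n u v"
  by (simp add: braid_class_def braid_rel_def)

lemma carrier_braid_group: "carrier (braid_group n) = braid_class n ` braid_words n"
  by (auto simp: braid_group_def braid_class_def quotient_def)

lemma braid_group_cases:
  assumes "x \<in> carrier (braid_group n)"
  obtains w where "w \<in> braid_words n" "x = braid_class n w"
  using assms by (auto simp: carrier_braid_group)

lemma braid_class_closed: "w \<in> braid_words n \<Longrightarrow> braid_class n w \<in> carrier (braid_group n)"
  by (simp add: carrier_braid_group)

lemma one_braid_group: "\<one>\<^bsub>braid_group n\<^esub> = braid_class n []"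
  by (simp add: braid_group_def)

lemma braid_equiv_append:
  assumes "braid_equiv n u u'" "braid_equiv n v v'"
  shows "braid_equiv n (u @ v) (u' @ v')"
proof (rule braid_equiv.trans)
  show "braid_equiv n (u @ v) (u' @ v)"
    using braid_equiv.ctxt[OF assms(1), of "[]" v] braid_equiv_words[OF assms(2)] by simp
  show "braid_equiv n (u' @ v) (u' @ v')"
    using braid_equiv.ctxt[OF assms(2), of u' "[]"] braid_equiv_words[OF assms(1)] by simp
qed

lemma mult_braid_group:
  assumes "u \<in> braid_words n" "v \<in> braid_words n"
  shows "braid_class n u \<otimes>\<^bsub>braid_group n\<^esub> braid_class n v = braid_class n (u @ v)"
proof -
  have eq: "braid_class n (u' @ v') = braid_class n (u @ v)"
    if uv: "u' \<in> braid_class n u" "v' \<in> braid_class n v" for u' v'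
  proof -
    have "braid_equiv n (u @ v) (u' @ v')"
      using uv by (intro braid_equiv_append) simp_all
    then show ?thesis
      using braid_class_eq_iff[OF braid_equiv_words] by blast
  qed
  have ne: "braid_class n u \<noteq> {}" "braid_class n v \<noteq> {}"
    using assms braid_equiv.refl mem_braid_class by blast+
  have "(\<Union>u'\<in>braid_class n u. \<Union>v'\<in>braid_class n v. braid_class n (u' @ v')) =
      (\<Union>u'\<in>braid_class n u. \<Union>v'\<in>braid_class n v. braid_class n (u @ v))"
    by (intro SUP_cong[OF HOL.refl] eq)
  then show ?thesis
    using ne by (simp add: braid_group_def)
qed

lemma inv_word:
  assumes "w \<in> braid_words n"
  shows "braid_equiv n (rev (map inv_letter w) @ w) [] \<and> rev (map inv_letter w) \<in> braid_words n"
  using assms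
proof (induction w)
  case Nil
  then show ?case by (simp add: braid_equiv.refl)
next
  case (Cons l w)
  let ?r = "rev (map inv_letter w)"
  have l: "[l] \<in> braid_words n" and w: "w \<in> braid_words n" using Cons.prems braid_words_Cons by blast+
  have "braid_equiv n [inv_letter l, inv_letter (inv_letter l)] []"
    using l by (intro braid_equiv.cancel) simp
  moreover have "inv_letter (inv_letter l) = l" by (cases l) auto
  ultimately have "braid_equiv n (?r @ [inv_letter l, l] @ w) (?r @ [] @ w)"
    using Cons.IH w by (intro braid_equiv.ctxt) auto
  then have "braid_equiv n (?r @ [inv_letter l, l] @ w) []"
    using Cons.IH[OF w] by (simp add: braid_equiv.trans[of n _ "?r @ w"])
  then show ?case using Cons.IH[OF w] l by simp
qed

lemma group_braid_group: "group (braid_group n)"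
proof (rule groupI)
  fix x assume "x \<in> carrier (braid_group n)"
  then obtain w where w: "w \<in> braid_words n" and x: "x = braid_class n w"
    by (rule braid_group_cases)
  let ?v = "rev (map inv_letter w)"
  have "braid_class n ?v \<in> carrier (braid_group n)"
    using inv_word[OF w] by (intro braid_class_closed) simp
  moreover have "braid_class n ?v \<otimes>\<^bsub>braid_group n\<^esub> x = \<one>\<^bsub>braid_group n\<^esub>"
    using inv_word[OF w] w
    by (simp add: x one_braid_group mult_braid_group braid_class_eq_iff)
  ultimately show "\<exists>y\<in>carrier (braid_group n). y \<otimes>\<^bsub>braid_group n\<^esub> x = \<one>\<^bsub>braid_group n\<^esub>"
    by blast
qed (auto elim!: braid_group_cases simp: one_braid_group mult_braid_group braid_class_closed)

definition braid_gen :: "nat \<Rightarrow> nat \<Rightarrow> letter list set" where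
  "braid_gen n i = braid_class n [Gen i]"

fun eval_letter :: "('a, 'b) monoid_scheme \<Rightarrow> (nat \<Rightarrow> 'a) \<Rightarrow> letter \<Rightarrow> 'a" where
  "eval_letter H f (Gen i) = f i"
| "eval_letter H f (Gen_inv i) = inv\<^bsub>H\<^esub> (f i)"

definition eval_word :: "('a, 'b) monoid_scheme \<Rightarrow> (nat \<Rightarrow> 'a) \<Rightarrow> letter list \<Rightarrow> 'a" where
  "eval_word H f w = foldr (\<lambda>l x. eval_letter H f l \<otimes>\<^bsub>H\<^esub> x) w \<one>\<^bsub>H\<^esub>"

definition braid_lift :: "('a, 'b) monoid_scheme \<Rightarrow> (nat \<Rightarrow> 'a) \<Rightarrow> letter list set \<Rightarrow> 'a" where
  "braid_lift H f \<beta> = the_elem (eval_word H f ` \<beta>)"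

text \<open>
  If \<open>f\<close> satisfies the Artin relations in \<open>H\<close>, then \<^term>\<open>braid_lift H f\<close> is well defined on
  the classes of words and is the homomorphism sending the \<open>i\<close>-th generator to \<open>f i\<close>.
\<close>

locale braid_rep = group H for n :: nat and H (structure) and f +
  assumes f_closed: "\<lbrakk>1 \<le> i; i < n\<rbrakk> \<Longrightarrow> f i \<in> carrier H"
    and f_braid: "\<lbrakk>1 \<le> i; i + 1 < n\<rbrakk> \<Longrightarrow> f i \<otimes> (f (i + 1) \<otimes> f i) = f (i + 1) \<otimes> (f i \<otimes> f (i + 1))"
    and f_comm: "\<lbrakk>1 \<le> i; i + 2 \<le> j; j < n\<rbrakk> \<Longrightarrow> f i \<otimes> f j = f j \<otimes> f i"
begin

lemma eval_letter_closed: "[l] \<in> braid_words n \<Longrightarrow> eval_letter H f l \<in> carrier H"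
  by (cases l) (auto simp: f_closed)

lemma eval_word_closed: "w \<in> braid_words n \<Longrightarrow> eval_word H f w \<in> carrier H"
proof (induction w)
  case (Cons l w)
  then have "[l] \<in> braid_words n" "w \<in> braid_words n" using braid_words_Cons by blast+
  then show ?case using Cons.IH eval_letter_closed by (simp add: eval_word_def)
qed (simp add: eval_word_def)

lemma eval_word_append:
  "u \<in> braid_words n \<Longrightarrow> v \<in> braid_words n \<Longrightarrow>
    eval_word H f (u @ v) = eval_word H f u \<otimes> eval_word H f v"
proof (induction u)
  case Nil
  then show ?case using eval_word_closed[of v] by (simp add: eval_word_def)
next
  case (Cons l u)
  then have "[l] \<in> braid_words n" "u \<in> braid_words n" using braid_words_Cons by blast+
  then show ?case
    using Cons eval_letter_closed[of l] eval_word_closed[of u] eval_word_closed[of v]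
    by (simp add: eval_word_def m_assoc)
qed

lemma eval_word_cong: "braid_equiv n u v \<Longrightarrow> eval_word H f u = eval_word H f v"
proof (induction rule: braid_equiv.induct)
  case (ctxt u v p q)
  then show ?case
    using braid_equiv_words[OF ctxt.hyps(1)] by (simp add: eval_word_append)
next
  case (cancel l)
  then show ?case
    by (cases l) (auto simp: eval_word_def f_closed)
next
  case (braid i)
  then show ?case using f_braid[of i] f_closed[of i] f_closed[of "i + 1"]
    by (simp add: eval_word_def)
next
  case (comm i j)
  then show ?case using f_comm[of i j] f_closed[of i] f_closed[of j]
    by (simp add: eval_word_def)
qed auto

lemma braid_lift_class:
  assumes "w \<in> braid_words n"
  shows "braid_lift H f (braid_class n w) = eval_word H f w"
proof -
  have "eval_word H f ` braid_class n w = {eval_word H f w}"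
  proof (intro equalityI subsetI)
    fix x assume "x \<in> eval_word H f ` braid_class n w"
    then show "x \<in> {eval_word H f w}" using eval_word_cong by fastforce
  next
    fix x assume "x \<in> {eval_word H f w}"
    then show "x \<in> eval_word H f ` braid_class n w"
      using braid_equiv.refl[OF assms] by (intro image_eqI[of _ _ w]) simp_all
  qed
  then show ?thesis by (simp add: braid_lift_def)
qed

lemma braid_lift_gen:
  assumes "1 \<le> i" "i < n"
  shows "braid_lift H f (braid_gen n i) = f i"
  using assms braid_lift_class[of "[Gen i]"] f_closed
  by (simp add: braid_gen_def eval_word_def)

lemma braid_lift_hom: "braid_lift H f \<in> hom (braid_group n) H"
  by (rule homI)
    (auto elim!: braid_group_cases
      simp: mult_braid_group braid_lift_class eval_word_closed eval_word_append)

end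


section \<open>The Hurwitz action\<close>

definition tuples :: "('a, 'b) monoid_scheme \<Rightarrow> nat \<Rightarrow> 'a list set" where
  "tuples G k = {xs. length xs = k \<and> set xs \<subseteq> carrier G}"

text \<open>
  Tuple entries are numbered from 1, list entries from 0; so \<open>X\<^sub>i\<close> is \<^term>\<open>xs ! (i - 1)\<close>.
\<close>

definition hurwitz_move :: "('a, 'b) monoid_scheme \<Rightarrow> nat \<Rightarrow> nat \<Rightarrow> 'a list \<Rightarrow> 'a list" where
  "hurwitz_move G k i = (\<lambda>xs\<in>tuples G k.
    xs[i - 1 := xs ! (i - 1) \<otimes>\<^bsub>G\<^esub> xs ! i \<otimes>\<^bsub>G\<^esub> inv\<^bsub>G\<^esub> (xs ! (i - 1)), i := xs ! (i - 1)])"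

definition hurwitz_action ::
    "('a, 'b) monoid_scheme \<Rightarrow> nat \<Rightarrow> letter list set \<Rightarrow> 'a list \<Rightarrow> 'a list" where
  "hurwitz_action G k = braid_lift (BijGroup (tuples G k)) (hurwitz_move G k)"

definition hurwitz_equivalent :: "('a, 'b) monoid_scheme \<Rightarrow> 'a list \<Rightarrow> 'a list \<Rightarrow> bool" where
  "hurwitz_equivalent G xs ys \<longleftrightarrow> (\<exists>k. xs \<in> tuples G k \<and> ys \<in> tuples G k \<and>
    ys \<in> orbit (braid_group k) (hurwitz_action G k) xs)"

context group
begin

lemma inv_cancel: "a \<in> carrier G \<Longrightarrow> b \<in> carrier G \<Longrightarrow> inv a \<otimes> (a \<otimes> b) = b"
  by (simp add: m_assoc[symmetric])

lemma tuples_nth: "xs \<in> tuples G k \<Longrightarrow> j < k \<Longrightarrow> xs ! j \<in> carrier G"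
  by (auto simp: tuples_def)

lemma tuples_update: "xs \<in> tuples G k \<Longrightarrow> x \<in> carrier G \<Longrightarrow> xs[j := x] \<in> tuples G k"
  using set_update_subset_insert by (fastforce simp: tuples_def)

lemma hurwitz_move_closed:
  assumes "1 \<le> i" "i < k" "xs \<in> tuples G k"
  shows "hurwitz_move G k i xs \<in> tuples G k"
  using assms by (auto simp: hurwitz_move_def tuples_nth intro!: tuples_update)

lemma hurwitz_move_length:
  "xs \<in> tuples G k \<Longrightarrow> length (hurwitz_move G k i xs) = k"
  by (simp add: hurwitz_move_def tuples_def)

lemma hurwitz_move_nth:
  assumes "1 \<le> i" "i < k" "xs \<in> tuples G k" "j < k"
  shows "hurwitz_move G k i xs ! j =
    (if j = i then xs ! (i - 1)
     else if Suc j = i then xs ! j \<otimes> xs ! i \<otimes> inv (xs ! j)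
     else xs ! j)"
  using assms by (auto simp: hurwitz_move_def tuples_def nth_list_update)

lemma hurwitz_move_Bij:
  assumes i: "1 \<le> i" "i < k"
  shows "hurwitz_move G k i \<in> Bij (tuples G k)"
proof -
  define g where "g ys = ys[i - 1 := ys ! i, i := inv (ys ! i) \<otimes> ys ! (i - 1) \<otimes> ys ! i]"
    for ys
  have "bij_betw (hurwitz_move G k i) (tuples G k) (tuples G k)"
  proof (rule bij_betw_byWitness[where f' = g])
    show "\<forall>xs\<in>tuples G k. g (hurwitz_move G k i xs) = xs"
    proof
      fix xs assume xs: "xs \<in> tuples G k"
      have "inv (xs ! (i - 1)) \<otimes> (xs ! (i - 1) \<otimes> xs ! i \<otimes> inv (xs ! (i - 1))) \<otimes> xs ! (i - 1)
          = xs ! i"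
        using tuples_nth[OF xs, of i] tuples_nth[OF xs, of "i - 1"] i less_imp_diff_less[of i k 1]
        by (simp add: m_assoc inv_cancel)
      then show "g (hurwitz_move G k i xs) = xs"
        using i xs
        by (intro nth_equalityI)
          (auto simp: g_def hurwitz_move_length hurwitz_move_nth nth_list_update tuples_def)
    qed
    show g: "g ` tuples G k \<subseteq> tuples G k"
      using i by (auto simp: g_def tuples_nth intro!: tuples_update)
    show "\<forall>ys\<in>tuples G k. hurwitz_move G k i (g ys) = ys"
    proof
      fix ys assume ys: "ys \<in> tuples G k"
      have "ys ! i \<otimes> (inv (ys ! i) \<otimes> ys ! (i - 1) \<otimes> ys ! i) \<otimes> inv (ys ! i) = ys ! (i - 1)"
        using tuples_nth[OF ys, of i] tuples_nth[OF ys, of "i - 1"] i less_imp_diff_less[of i k 1]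
        by (simp add: m_assoc[symmetric]) (simp add: m_assoc)
      moreover have "g ys \<in> tuples G k" using g ys by blast
      ultimately show "hurwitz_move G k i (g ys) = ys"
        using i ys
        by (intro nth_equalityI)
          (auto simp: hurwitz_move_length hurwitz_move_nth, auto simp: g_def nth_list_update tuples_def)
    qed
    show "hurwitz_move G k i ` tuples G k \<subseteq> tuples G k"
      using i hurwitz_move_closed by blast
  qed
  then show ?thesis by (auto simp: Bij_def hurwitz_move_def)
qed

lemma hurwitz_move_braid:
  assumes "1 \<le> i" "i + 1 < k" "xs \<in> tuples G k"
  shows "hurwitz_move G k i (hurwitz_move G k (i + 1) (hurwitz_move G k i xs)) =
    hurwitz_move G k (i + 1) (hurwitz_move G k i (hurwitz_move G k (i + 1) xs))"
proof -
  have c: "xs ! (i - 1) \<in> carrier G" "xs ! i \<in> carrier G" "xs ! (i + 1) \<in> carrier G"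
    using assms by (auto intro: tuples_nth)
  show ?thesis
    using assms c
    by (intro nth_equalityI)
      (auto simp: hurwitz_move_length hurwitz_move_nth hurwitz_move_closed m_assoc
        inv_mult_group inv_cancel)
qed

lemma hurwitz_move_comm:
  assumes "1 \<le> i" "i + 2 \<le> j" "j < k" "xs \<in> tuples G k"
  shows "hurwitz_move G k i (hurwitz_move G k j xs) = hurwitz_move G k j (hurwitz_move G k i xs)"
  using assms
  by (intro nth_equalityI)
    (auto simp: hurwitz_move_length hurwitz_move_nth hurwitz_move_closed)

lemma braid_rep_hurwitz: "braid_rep k (BijGroup (tuples G k)) (hurwitz_move G k)"
proof (intro braid_rep.intro braid_rep_axioms.intro)
  show "group (BijGroup (tuples G k))" by (rule group_BijGroup)
next
  fix i assume "1 \<le> i" "i < k"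
  then show "hurwitz_move G k i \<in> carrier (BijGroup (tuples G k))"
    using hurwitz_move_Bij by (simp add: BijGroup_def)
next
  fix i assume i: "1 \<le> i" "i + 1 < k"
  let ?T = "tuples G k" and ?f = "hurwitz_move G k"
  have B: "?f i \<in> Bij ?T" "?f (i + 1) \<in> Bij ?T"
    using i by (auto intro: hurwitz_move_Bij)
  have "compose ?T (?f i) (compose ?T (?f (i + 1)) (?f i)) =
      compose ?T (?f (i + 1)) (compose ?T (?f i) (?f (i + 1)))"
    unfolding compose_def using hurwitz_move_braid[OF i] by (intro restrict_ext) simp
  then show "?f i \<otimes>\<^bsub>BijGroup ?T\<^esub> (?f (i + 1) \<otimes>\<^bsub>BijGroup ?T\<^esub> ?f i) =
      ?f (i + 1) \<otimes>\<^bsub>BijGroup ?T\<^esub> (?f i \<otimes>\<^bsub>BijGroup ?T\<^esub> ?f (i + 1))"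
    using B compose_Bij[OF B] compose_Bij[OF B(2,1)] by (simp add: BijGroup_def)
next
  fix i j assume "1 \<le> i" "i + 2 \<le> j" "j < k"
  then show "hurwitz_move G k i \<otimes>\<^bsub>BijGroup (tuples G k)\<^esub> hurwitz_move G k j =
      hurwitz_move G k j \<otimes>\<^bsub>BijGroup (tuples G k)\<^esub> hurwitz_move G k i"
    using hurwitz_move_comm[of i j k]
    by (auto simp: BijGroup_def hurwitz_move_Bij compose_def intro!: restrict_ext)
qed

lemma group_action_hurwitz:
  "group_action (braid_group k) (tuples G k) (hurwitz_action G k)"
  unfolding hurwitz_action_def
  by (intro group_action.intro group_hom.intro group_hom_axioms.intro group_braid_group
      group_BijGroup braid_rep.braid_lift_hom braid_rep_hurwitz)

lemma hurwitz_action_gen: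
  "1 \<le> i \<Longrightarrow> i < k \<Longrightarrow> hurwitz_action G k (braid_gen k i) = hurwitz_move G k i"
  unfolding hurwitz_action_def by (rule braid_rep.braid_lift_gen[OF braid_rep_hurwitz])

end


section \<open>Braids with three strings\<close>

abbreviation B3 :: "letter list set monoid" where
  "B3 \<equiv> braid_group 3"

definition \<sigma>\<^sub>1 :: "letter list set" where
  "\<sigma>\<^sub>1 = braid_gen 3 1"

definition \<sigma>\<^sub>2 :: "letter list set" where
  "\<sigma>\<^sub>2 = braid_gen 3 2"

definition \<sigma>\<^sub>0 :: "letter list set" where
  "\<sigma>\<^sub>0 = inv\<^bsub>B3\<^esub> \<sigma>\<^sub>1 \<otimes>\<^bsub>B3\<^esub> \<sigma>\<^sub>2 \<otimes>\<^bsub>B3\<^esub> \<sigma>\<^sub>1"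

definition list_prod :: "('a, 'b) monoid_scheme \<Rightarrow> 'a list \<Rightarrow> 'a" where
  "list_prod G xs = foldr (\<otimes>\<^bsub>G\<^esub>) xs \<one>\<^bsub>G\<^esub>"

definition conjugate :: "('a, 'b) monoid_scheme \<Rightarrow> 'a \<Rightarrow> 'a \<Rightarrow> bool" where
  "conjugate G x y \<longleftrightarrow> (\<exists>g\<in>carrier G. x = g \<otimes>\<^bsub>G\<^esub> y \<otimes>\<^bsub>G\<^esub> inv\<^bsub>G\<^esub> g)"

definition BKL_positive :: "letter list set \<Rightarrow> bool" where
  "BKL_positive X \<longleftrightarrow> (\<exists>ws. set ws \<subseteq> {\<sigma>\<^sub>0, \<sigma>\<^sub>1, \<sigma>\<^sub>2} \<and> list_prod B3 ws = X)"

definition quasipositive_factorization :: "letter list set \<Rightarrow> letter list set list \<Rightarrow> bool" where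
  "quasipositive_factorization X xs \<longleftrightarrow>
    list_prod B3 xs = X \<and> (\<forall>x\<in>set xs. conjugate B3 x \<sigma>\<^sub>1)"

end

theory Submission
  imports Defs "HOL-Algebra.Elementary_Groups"
begin

text \<open>
  The atoms \<open>\<sigma>\<^sub>0, \<sigma>\<^sub>1, \<sigma>\<^sub>2\<close> satisfy \<open>\<delta> = \<sigma>\<^sub>2\<sigma>\<^sub>1 = \<sigma>\<^sub>1\<sigma>\<^sub>0 = \<sigma>\<^sub>0\<sigma>\<^sub>2\<close>, and conjugation by \<open>\<delta>\<close>
  permutes them cyclically. The cosets of \<open>\<langle>\<delta>\<rangle>\<close> are the vertices of a trivalent tree on which
  the braid group acts by isometries; a vertex is named by the reduced path from the root, that is
  by a word in the atoms without two consecutive letters of product \<open>\<delta>\<close>. Let \<open>|g|\<close> be the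
  distance by which \<open>g\<close> moves the root. Each atom moves the root by 1, so a product of \<open>k\<close> atoms
  satisfies \<open>|X| \<le> k\<close>, and \<open>k\<close> is the exponent sum of \<open>X\<close>. BKL-positivity
  enters the first half of the proof through this inequality.

  A conjugate of \<open>\<sigma>\<^sub>1\<close> acts on the tree as a translation by 1 along an axis. It can be written
  \<open>Q x Q\<^sup>-\<^sup>1\<close> with an atom \<open>x\<close> and \<open>Q\<close> the shortest path from the root to the axis, and then it has
  length \<open>2|Q| + 1\<close>: the path to the image of the root runs along \<open>Q\<close>, crosses one middle edge on
  the axis and leaves the axis again. Take a factorization of \<open>X\<close> and consider,
  as in Nielsen's method for free groups, how much of two neighbouring factors cancels.
  If the cancellation reaches the middle edge of one of them, a Hurwitz move
  replaces the longer one by a shorter conjugate (\<open>conj_shortens\<close>), except when the two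
  factors are atoms of product \<open>\<delta>\<close>; but such a pair can be carried next to any factor of length
  above 1, put into whichever of its three forms is suitable, and used to shorten that factor
  (\<open>shorten_by_delta_pair\<close>). If no middle edge is ever reached, all \<open>k\<close> middle edges survive
  in the product together with further edges as soon as one factor is not an atom, so that
  \<open>|X| > k\<close> (\<open>len_list_prod_lower\<close>), which is excluded. Hence every quasipositive
  factorization of a BKL-positive braid can be shortened until it consists of atoms.

  Two factorizations into atoms are compared through the tree again. A reduced word is
  read off from the image of the root, so it is determined by its product. In a word that is not
  reduced, a pair of product \<open>\<delta>\<close> can be moved to the front and brought to the form
  \<open>(\<sigma>\<^sub>2, \<sigma>\<^sub>1)\<close>; cancelling it leaves two shorter words with equal products.
\<close>

section \<open>Hurwitz equivalence in a group\<close>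

lemma list_prod_Nil [simp]: "list_prod G [] = \<one>\<^bsub>G\<^esub>"
  by (simp add: list_prod_def)

lemma list_prod_Cons [simp]: "list_prod G (x # xs) = x \<otimes>\<^bsub>G\<^esub> list_prod G xs"
  by (simp add: list_prod_def)

context group
begin

definition conj_by :: "'a \<Rightarrow> 'a \<Rightarrow> 'a" where
  "conj_by g x = g \<otimes> x \<otimes> inv g"

lemma conj_by_closed [simp]:
  "g \<in> carrier G \<Longrightarrow> x \<in> carrier G \<Longrightarrow> conj_by g x \<in> carrier G"
  by (simp add: conj_by_def)

lemma conj_by_mult:
  "g \<in> carrier G \<Longrightarrow> h \<in> carrier G \<Longrightarrow> x \<in> carrier G \<Longrightarrow>
    conj_by (g \<otimes> h) x = conj_by g (conj_by h x)"
  by (simp add: conj_by_def m_assoc inv_mult_group)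

lemma conj_by_inv [simp]:
  assumes "g \<in> carrier G" "x \<in> carrier G"
  shows "conj_by g (conj_by (inv g) x) = x" "conj_by (inv g) (conj_by g x) = x"
proof -
  show "conj_by g (conj_by (inv g) x) = x"
    using conj_by_mult[of g "inv g" x] assms by (simp add: conj_by_def)
  show "conj_by (inv g) (conj_by g x) = x"
    using conj_by_mult[of "inv g" g x] assms by (simp add: conj_by_def)
qed

lemma conj_by_commute:
  "g \<in> carrier G \<Longrightarrow> x \<in> carrier G \<Longrightarrow> conj_by g x \<otimes> g = g \<otimes> x"
  by (simp add: conj_by_def m_assoc)

lemma conjugate_conj_by:
  assumes "g \<in> carrier G" "x \<in> carrier G" "y \<in> carrier G"
  shows "conjugate G (conj_by g x) y \<longleftrightarrow> conjugate G x y"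
proof -
  have aux: "conjugate G (conj_by g x) y" if "conjugate G x y" "g \<in> carrier G" for x g
  proof -
    from that obtain h where h: "h \<in> carrier G" "x = conj_by h y"
      by (auto simp: conjugate_def conj_by_def)
    have "conj_by g x = conj_by (g \<otimes> h) y" using h that assms by (simp add: conj_by_mult)
    then show ?thesis
      unfolding conjugate_def using h(1) that(2)
      by (intro bexI[of _ "g \<otimes> h"]) (simp_all add: conj_by_def)
  qed
  show ?thesis
    using aux[of x g] aux[of "conj_by g x" "inv g"] assms by auto
qed

lemma list_prod_closed [simp]: "set xs \<subseteq> carrier G \<Longrightarrow> list_prod G xs \<in> carrier G"
  by (induction xs) auto

lemma list_prod_append:
  "set xs \<subseteq> carrier G \<Longrightarrow> set ys \<subseteq> carrier G \<Longrightarrow>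
    list_prod G (xs @ ys) = list_prod G xs \<otimes> list_prod G ys"
  by (induction xs) (auto simp: m_assoc)

text \<open>
  The orbits of the Hurwitz action are the classes of the equivalence relation generated by
  single moves. This inductive form makes the block manipulations below compositional: it is
  stable under prefixing and suffixing, and needs no bookkeeping of positions.
\<close>

inductive hurwitz :: "'a list \<Rightarrow> 'a list \<Rightarrow> bool" where
  hrefl: "set xs \<subseteq> carrier G \<Longrightarrow> hurwitz xs xs"
| hsym: "hurwitz xs ys \<Longrightarrow> hurwitz ys xs"
| htrans: "hurwitz xs ys \<Longrightarrow> hurwitz ys zs \<Longrightarrow> hurwitz xs zs"
| hmove: "set as \<subseteq> carrier G \<Longrightarrow> set bs \<subseteq> carrier G \<Longrightarrow> x \<in> carrier G \<Longrightarrow> y \<in> carrier G \<Longrightarrow>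
    hurwitz (as @ x # y # bs) (as @ conj_by x y # x # bs)"

lemma hurwitz_carrier:
  "hurwitz xs ys \<Longrightarrow> set xs \<subseteq> carrier G \<and> set ys \<subseteq> carrier G"
  by (induction rule: hurwitz.induct) auto

lemma hurwitz_length: "hurwitz xs ys \<Longrightarrow> length xs = length ys"
  by (induction rule: hurwitz.induct) auto

lemma hurwitz_list_prod: "hurwitz xs ys \<Longrightarrow> list_prod G xs = list_prod G ys"
proof (induction rule: hurwitz.induct)
  case (hmove as bs x y)
  then have "x \<otimes> (y \<otimes> list_prod G bs) = conj_by x y \<otimes> (x \<otimes> list_prod G bs)"
    using conj_by_commute[of x y] by (simp flip: m_assoc)
  then show ?case using hmove by (simp add: list_prod_append)
qed auto

lemma hurwitz_conjugate:
  "hurwitz xs ys \<Longrightarrow> c \<in> carrier G \<Longrightarrow>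
    (\<forall>x\<in>set xs. conjugate G x c) \<longleftrightarrow> (\<forall>y\<in>set ys. conjugate G y c)"
  by (induction rule: hurwitz.induct) (auto simp: conjugate_conj_by)

lemma hurwitz_append:
  assumes "hurwitz xs ys" "set as \<subseteq> carrier G" "set bs \<subseteq> carrier G"
  shows "hurwitz (as @ xs @ bs) (as @ ys @ bs)"
  using assms
proof (induction rule: hurwitz.induct)
  case (hmove cs ds x y)
  then show ?case using hurwitz.hmove[of "as @ cs" "ds @ bs" x y] by simp
next
  case (hrefl xs)
  then show ?case by (intro hurwitz.hrefl) simp
next
  case (hsym xs ys)
  then show ?case by (simp add: hurwitz.hsym)
next
  case (htrans xs ys zs)
  then show ?case by (blast intro: hurwitz.htrans)
qed

lemma hurwitz_moves:
  assumes "x \<in> carrier G" "y \<in> carrier G"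
  shows "hurwitz [x, y] [conj_by x y, x]" "hurwitz [x, y] [y, conj_by (inv y) x]"
proof -
  show "hurwitz [x, y] [conj_by x y, x]"
    using hmove[of "[]" "[]" x y] assms by simp
  have "hurwitz [y, conj_by (inv y) x] [conj_by y (conj_by (inv y) x), y]"
    using hmove[of "[]" "[]" y "conj_by (inv y) x"] assms by simp
  then show "hurwitz [x, y] [y, conj_by (inv y) x]" using assms by (simp add: hsym)
qed

lemma hurwitz_pass_element:
  assumes "x \<in> carrier G" "set cs \<subseteq> carrier G"
  shows "hurwitz (x # cs) (map (conj_by x) cs @ [x])"
  using assms(2)
proof (induction cs)
  case Nil
  then show ?case using assms by (auto intro: hrefl)
next
  case (Cons c cs)
  have "hurwitz (x # c # cs) (conj_by x c # x # cs)"
    using hmove[of "[]" cs x c] assms Cons.prems by simp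
  moreover have "hurwitz ([conj_by x c] @ (x # cs) @ [])
      ([conj_by x c] @ (map (conj_by x) cs @ [x]) @ [])"
    using Cons assms by (intro hurwitz_append) auto
  ultimately show ?case by (auto intro: htrans)
qed

lemma hurwitz_pass_pair:
  assumes "x \<in> carrier G" "y \<in> carrier G" "set cs \<subseteq> carrier G"
  shows "hurwitz (x # y # cs) (map (conj_by (x \<otimes> y)) cs @ [x, y])"
proof -
  have m: "set (map (conj_by y) cs) \<subseteq> carrier G" using assms by auto
  have "hurwitz ([x] @ (y # cs) @ []) ([x] @ (map (conj_by y) cs @ [y]) @ [])"
    using assms hurwitz_pass_element[of y cs] by (intro hurwitz_append) auto
  moreover have "hurwitz ([] @ (x # map (conj_by y) cs) @ [y])
      ([] @ (map (conj_by x) (map (conj_by y) cs) @ [x]) @ [y])"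
    using assms m hurwitz_pass_element[of x "map (conj_by y) cs"] by (intro hurwitz_append) auto
  moreover have eq: "map (conj_by (x \<otimes> y)) cs = map (conj_by x) (map (conj_by y) cs)"
    using assms by (auto simp: conj_by_mult)
  ultimately show ?thesis
    unfolding eq using htrans[of "x # y # cs" "x # map (conj_by y) cs @ [y]"]
    by (simp del: map_map)
qed

text \<open>The same block motion read backwards, for moving a pair to the left.\<close>

lemma hurwitz_pull_pair:
  assumes "x \<in> carrier G" "y \<in> carrier G" "set cs \<subseteq> carrier G"
  shows "hurwitz (cs @ [x, y]) (x # y # map (conj_by (inv (x \<otimes> y))) cs)"
proof -
  let ?ds = "map (conj_by (inv (x \<otimes> y))) cs"
  have d: "set ?ds \<subseteq> carrier G" using assms by auto
  have "map (conj_by (x \<otimes> y)) ?ds = cs"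
    using assms by (auto simp: subset_iff intro!: map_idI)
  then show ?thesis using hurwitz_pass_pair[OF assms(1,2) d] by (simp add: hsym)
qed

lemma hurwitz_imp_equivalent:
  assumes "hurwitz xs ys"
  shows "hurwitz_equivalent G xs ys"
proof -
  define k where "k = length xs"
  have "ys \<in> orbit (braid_group k) (hurwitz_action G k) xs"
    using assms unfolding k_def
  proof (induction rule: hurwitz.induct)
    case (hrefl xs)
    then show ?case
      using group_action.orbit_refl[OF group_action_hurwitz] by (simp add: tuples_def)
  next
    case (hsym xs ys)
    then show ?case
      using group_action.orbit_sym[OF group_action_hurwitz, of xs "length xs" ys]
        hurwitz_carrier[OF hsym.hyps] hurwitz_length[OF hsym.hyps]
      by (simp add: tuples_def)
  next
    case (htrans xs ys zs)
    then show ?case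
      using group_action.orbit_trans[OF group_action_hurwitz, of xs "length xs" ys zs]
        hurwitz_carrier[OF htrans.hyps(1)] hurwitz_length[OF htrans.hyps(1)]
        hurwitz_carrier[OF htrans.hyps(2)] hurwitz_length[OF htrans.hyps(2)]
      by (simp add: tuples_def)
  next
    case (hmove as bs x y)
    let ?xs = "as @ x # y # bs" and ?i = "Suc (length as)"
    let ?k = "length ?xs"
    have i: "1 \<le> ?i" "?i < ?k" by auto
    have "?xs \<in> tuples G ?k" using hmove by (simp add: tuples_def)
    then have "hurwitz_move G ?k ?i ?xs = as @ conj_by x y # x # bs"
      by (simp add: hurwitz_move_def conj_by_def nth_append list_update_append)
    moreover have "braid_gen ?k ?i \<in> carrier (braid_group ?k)"
      using i by (simp add: braid_gen_def braid_class_closed)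
    ultimately show ?case
      unfolding orbit_def using hurwitz_action_gen[OF i] by (force intro: exI[of _ "braid_gen ?k ?i"])
  qed
  then show ?thesis
    unfolding hurwitz_equivalent_def
    using hurwitz_carrier[OF assms] hurwitz_length[OF assms]
    by (intro exI[of _ k]) (simp add: tuples_def k_def)
qed

end

section \<open>The trivalent tree\<close>

text \<open>The cyclic order is chosen so that an atom times the next one is always \<open>\<sigma>\<^sub>2\<sigma>\<^sub>1\<close>.\<close>

datatype atom = S0 | S1 | S2

fun next_atom :: "atom \<Rightarrow> atom" where
  "next_atom S2 = S1"
| "next_atom S1 = S0"
| "next_atom S0 = S2"

lemma next_atom_cube [simp]: "next_atom (next_atom (next_atom x)) = x"
  by (cases x) auto

lemma next_atom_neq [simp]:
  "next_atom x \<noteq> x" "x \<noteq> next_atom x"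
  "next_atom (next_atom x) \<noteq> x" "x \<noteq> next_atom (next_atom x)"
  "next_atom x \<noteq> next_atom (next_atom x)" "next_atom (next_atom x) \<noteq> next_atom x"
  by (cases x; simp)+

lemma next_atom_inject [simp]: "next_atom x = next_atom y \<longleftrightarrow> x = y"
  by (cases x; cases y; simp)

lemma next_atom_square_eq_iff: "next_atom (next_atom x) = y \<longleftrightarrow> x = next_atom y"
  by (cases x; cases y; simp)

abbreviation rot :: "atom list \<Rightarrow> atom list" where
  "rot \<equiv> map next_atom"

text \<open>The inverse of \<open>rot\<close>, written as its square.\<close>

abbreviation rot' :: "atom list \<Rightarrow> atom list" where
  "rot' \<equiv> map (\<lambda>x. next_atom (next_atom x))"

text \<open>
  A reduced list is a path from the root of a trivalent tree that never turns back. A step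
  \<open>x\<close> followed by \<open>next_atom x\<close> returns to where it came from, which leaves two
  continuations at each vertex other than the root.
\<close>

definition reduced :: "atom list \<Rightarrow> bool" where
  "reduced = successively (\<lambda>x y. y \<noteq> next_atom x)"

lemma reduced_simps [simp]:
  "reduced []" "reduced [x]" "reduced (x # y # zs) \<longleftrightarrow> y \<noteq> next_atom x \<and> reduced (y # zs)"
  by (auto simp: reduced_def)

lemma reduced_Cons: "reduced (x # xs) \<longleftrightarrow> (xs = [] \<or> hd xs \<noteq> next_atom x) \<and> reduced xs"
  by (cases xs) auto

lemma reduced_append:
  "reduced (xs @ ys) \<longleftrightarrow>
    reduced xs \<and> reduced ys \<and> (xs = [] \<or> ys = [] \<or> hd ys \<noteq> next_atom (last xs))"
  by (auto simp: reduced_def successively_append_iff)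

lemma reduced_rot [simp]: "reduced (rot xs) = reduced xs" "reduced (rot' xs) = reduced xs"
  by (simp_all add: reduced_def successively_map next_atom_square_eq_iff)

lemma not_reducedE:
  assumes "\<not> reduced xs"
  obtains as u bs where "xs = as @ u # next_atom u # bs"
  using assms
proof (induction xs arbitrary: thesis)
  case (Cons x xs)
  show ?case
  proof (cases "reduced xs")
    case True
    then have "xs \<noteq> []" "hd xs = next_atom x" using Cons.prems(2) by (auto simp: reduced_Cons)
    then show ?thesis using Cons.prems(1)[of "[]" x "tl xs"] by (cases xs) auto
  next
    case False
    then obtain as u bs where "xs = as @ u # next_atom u # bs" using Cons.IH by blast
    then show ?thesis using Cons.prems(1)[of "x # as" u bs] by simp
  qed
qed simp

text \<open>
  Left multiplication by an atom on cosets of \<open>\<delta>\<close>. In the backtracking case the first two letters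
  merge to \<open>\<delta>\<close>, which is then moved to the right end, where it disappears; on its way it
  rotates the remaining letters.
\<close>

fun push :: "atom \<Rightarrow> atom list \<Rightarrow> atom list" where
  "push x [] = [x]"
| "push x (z # zs) = (if z = next_atom x then rot zs else x # z # zs)"

lemma push_cons: "zs = [] \<or> hd zs \<noteq> next_atom x \<Longrightarrow> push x zs = x # zs"
  by (cases zs) auto

lemma reduced_push: "reduced zs \<Longrightarrow> reduced (push x zs)"
  by (cases zs) (auto simp: reduced_Cons)

lemma rot_push: "rot (push x zs) = push (next_atom x) (rot zs)"
  by (cases zs) auto

lemma rot'_push: "rot' (push x zs) = push (next_atom (next_atom x)) (rot' zs)"
  by (cases zs) auto

text \<open>
  On the tree, the product of an atom and its successor is the rotation about the root.
\<close>

lemma push_push: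
  assumes "reduced zs"
  shows "push x (push (next_atom x) zs) = rot zs"
proof (cases zs)
  case (Cons z ws)
  have "rot ws = [] \<or> hd (rot ws) \<noteq> next_atom x" if "z = next_atom (next_atom x)"
    using assms Cons that by (cases ws) auto
  then show ?thesis using Cons by (auto simp: push_cons)
qed simp

text \<open>
  The inverse of \<open>push\<close>: the inverse of an atom \<open>x\<close> is \<open>next_atom x\<close> times \<open>\<delta>\<^sup>-\<^sup>1\<close>.
\<close>

definition pull :: "atom \<Rightarrow> atom list \<Rightarrow> atom list" where
  "pull x zs = push (next_atom x) (rot' zs)"

lemma push_pull:
  assumes "reduced zs"
  shows "push x (pull x zs) = zs" "pull x (push x zs) = zs"
proof -
  have rr: "rot (rot' zs) = zs" by (simp add: o_def)
  show "push x (pull x zs) = zs"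
    unfolding pull_def using push_push[of "rot' zs" x] rr assms by simp
  show "pull x (push x zs) = zs"
    unfolding pull_def rot'_push using push_push[of "rot' zs" "next_atom x"] rr assms by simp
qed

lemma reduced_pull: "reduced zs \<Longrightarrow> reduced (pull x zs)"
  by (simp add: pull_def reduced_push)

lemma pull_cons:
  assumes "zs = [] \<or> hd zs \<noteq> x"
  shows "pull x zs = next_atom x # rot' zs"
  unfolding pull_def using assms by (cases zs) auto

fun common :: "'a list \<Rightarrow> 'a list \<Rightarrow> nat" where
  "common (x # xs) (y # ys) = (if x = y then Suc (common xs ys) else 0)"
| "common _ _ = 0"

lemma common_Nil2 [simp]: "common xs [] = 0"
  by (cases xs) auto

lemma common_commute: "common xs ys = common ys xs"
  by (induction xs ys rule: common.induct) auto

text \<open>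
  The tree enters all metric arguments through this inequality: common prefix lengths are the
  Gromov products of a tree, hence 0-hyperbolic.
\<close>

lemma common_ultra: "min (common xs ys) (common ys zs) \<le> common xs zs"
proof (induction xs zs arbitrary: ys rule: common.induct)
  case (1 x xs z zs)
  show ?case
  proof (cases ys)
    case (Cons y ws)
    then show ?thesis using "1.IH"[of ws] by auto
  qed auto
qed auto

lemma common_self [simp]: "common xs xs = length xs"
  by (induction xs) auto

lemma common_append: "common (xs @ ys) (xs @ zs) = length xs + common ys zs"
  by (induction xs) auto

lemma take_common:
  "n \<le> common xs ys \<Longrightarrow> take n xs = take n ys"
proof (induction xs ys arbitrary: n rule: common.induct)
  case (1 x xs y ys)
  then show ?case by (cases n) (auto split: if_splits)
qed auto

lemma common_rot [simp]: "common (rot xs) (rot ys) = common xs ys"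
  by (induction xs ys rule: common.induct) auto

definition tdist :: "atom list \<Rightarrow> atom list \<Rightarrow> int" where
  "tdist xs ys = int (length xs) + int (length ys) - 2 * int (common xs ys)"

lemma common_hd_neq: "xs = [] \<or> ys = [] \<or> hd xs \<noteq> hd ys \<Longrightarrow> common xs ys = 0"
  by (cases xs; cases ys) auto

lemma tdist_push:
  assumes "reduced xs" "reduced ys"
  shows "tdist (push x xs) (push x ys) = tdist xs ys"
proof -
  \<comment> \<open>If only one of the two paths starts along the edge in question, then both before and after
     the move the root lies on the geodesic between their ends.\<close>
  have aux: "tdist (rot vs) (x # ws) = tdist (next_atom x # vs) ws"
    if "reduced (next_atom x # vs)" "ws = [] \<or> hd ws \<noteq> next_atom x" for vs ws
  proof -
    have "common (rot vs) (x # ws) = 0"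
      using that(1) by (intro common_hd_neq) (cases vs; auto)
    moreover have "common (next_atom x # vs) ws = 0"
      using that(2) by (intro common_hd_neq) auto
    ultimately show ?thesis by (simp add: tdist_def)
  qed
  have sym: "tdist as bs = tdist bs as" for as bs
    by (simp add: tdist_def common_commute)
  consider (bb) vs ws where "xs = next_atom x # vs" "ys = next_atom x # ws"
    | (bn) vs where "xs = next_atom x # vs" "ys = [] \<or> hd ys \<noteq> next_atom x"
    | (nb) ws where "ys = next_atom x # ws" "xs = [] \<or> hd xs \<noteq> next_atom x"
    | (nn) "xs = [] \<or> hd xs \<noteq> next_atom x" "ys = [] \<or> hd ys \<noteq> next_atom x"
    by (metis list.collapse)
  then show ?thesis
  proof cases
    case bb
    then show ?thesis by (simp add: tdist_def)
  next
    case bn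
    then show ?thesis using aux[of vs ys] assms by (simp add: push_cons)
  next
    case nb
    then show ?thesis using aux[of ws xs] assms by (simp add: push_cons sym)
  next
    case nn
    then show ?thesis by (simp add: push_cons tdist_def)
  qed
qed

section \<open>The braid group on three strings acting on the tree\<close>

interpretation braid3: group B3
  by (rule group_braid_group)

abbreviation b3_mult (infixl "\<cdot>" 70) where "x \<cdot> y \<equiv> x \<otimes>\<^bsub>B3\<^esub> y"
abbreviation b3_inv where "b3_inv x \<equiv> inv\<^bsub>B3\<^esub> x"

fun val :: "atom \<Rightarrow> letter list set" where
  "val S0 = \<sigma>\<^sub>0"
| "val S1 = \<sigma>\<^sub>1"
| "val S2 = \<sigma>\<^sub>2"

definition word :: "atom list \<Rightarrow> letter list set" where
  "word xs = list_prod B3 (map val xs)"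

definition \<delta> :: "letter list set" where
  "\<delta> = \<sigma>\<^sub>2 \<cdot> \<sigma>\<^sub>1"

lemma sigma_closed [simp]: "\<sigma>\<^sub>1 \<in> carrier B3" "\<sigma>\<^sub>2 \<in> carrier B3" "\<sigma>\<^sub>0 \<in> carrier B3"
proof -
  show "\<sigma>\<^sub>1 \<in> carrier B3" "\<sigma>\<^sub>2 \<in> carrier B3"
    unfolding \<sigma>\<^sub>1_def \<sigma>\<^sub>2_def braid_gen_def by (simp_all add: braid_class_closed)
  then show "\<sigma>\<^sub>0 \<in> carrier B3" by (simp add: \<sigma>\<^sub>0_def)
qed

lemma val_closed [simp]: "val x \<in> carrier B3"
  by (cases x) auto

lemma set_map_val [simp]: "set (map val xs) \<subseteq> carrier B3" "val ` X \<subseteq> carrier B3"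
  by auto

lemma word_closed [simp]: "word xs \<in> carrier B3"
  by (simp add: word_def)

lemma delta_closed [simp]: "\<delta> \<in> carrier B3"
  by (simp add: \<delta>_def)

lemma word_simps [simp]:
  "word [] = \<one>\<^bsub>B3\<^esub>" "word (x # xs) = val x \<cdot> word xs"
  by (simp_all add: word_def)

lemma word_append: "word (xs @ ys) = word xs \<cdot> word ys"
  by (simp add: word_def braid3.list_prod_append)

lemma sigma_braid: "\<sigma>\<^sub>1 \<cdot> \<sigma>\<^sub>2 \<cdot> \<sigma>\<^sub>1 = \<sigma>\<^sub>2 \<cdot> \<sigma>\<^sub>1 \<cdot> \<sigma>\<^sub>2"
  using braid_equiv.braid[of 1 3]
  by (simp add: \<sigma>\<^sub>1_def \<sigma>\<^sub>2_def braid_gen_def mult_braid_group braid_class_eq_iff numeral_2_eq_2)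

lemma val_next: "val x \<cdot> val (next_atom x) = \<delta>"
proof (cases x)
  case S0
  have "\<sigma>\<^sub>0 \<cdot> \<sigma>\<^sub>2 = b3_inv \<sigma>\<^sub>1 \<cdot> (\<sigma>\<^sub>2 \<cdot> \<sigma>\<^sub>1 \<cdot> \<sigma>\<^sub>2)"
    by (simp add: \<sigma>\<^sub>0_def braid3.m_assoc)
  also have "\<dots> = \<delta>"
    by (simp add: sigma_braid[symmetric] \<delta>_def braid3.m_assoc braid3.inv_cancel)
  finally show ?thesis using S0 by simp
next
  case S1
  have "\<sigma>\<^sub>1 \<cdot> \<sigma>\<^sub>0 = (\<sigma>\<^sub>1 \<cdot> b3_inv \<sigma>\<^sub>1) \<cdot> (\<sigma>\<^sub>2 \<cdot> \<sigma>\<^sub>1)"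
    unfolding \<sigma>\<^sub>0_def by (simp only: braid3.m_assoc sigma_closed braid3.inv_closed braid3.m_closed)
  then show ?thesis using S1 by (simp add: \<delta>_def)
qed (simp add: \<delta>_def)

lemma delta_val: "\<delta> \<cdot> val x = val (next_atom x) \<cdot> \<delta>"
proof -
  have "\<delta> \<cdot> val x = val (next_atom x) \<cdot> val (next_atom (next_atom x)) \<cdot> val x"
    by (simp add: val_next)
  also have "\<dots> = val (next_atom x) \<cdot> (val (next_atom (next_atom x)) \<cdot> val (next_atom (next_atom (next_atom x))))"
    by (simp add: braid3.m_assoc)
  finally show ?thesis by (simp only: val_next)
qed

lemma conj_delta_val: "braid3.conj_by \<delta> (val x) = val (next_atom x)"
  by (simp add: braid3.conj_by_def delta_val braid3.m_assoc)

lemma conj_inv_delta_val: "braid3.conj_by (b3_inv \<delta>) (val x) = val (next_atom (next_atom x))"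
  using braid3.conj_by_inv(2)[of \<delta> "val (next_atom (next_atom x))"] by (simp add: conj_delta_val)

lemma conj_val_next: "braid3.conj_by (val x) (val (next_atom x)) = val (next_atom (next_atom x))"
proof -
  have "val (next_atom (next_atom x)) \<cdot> val x = val x \<cdot> val (next_atom x)"
    using val_next[of "next_atom (next_atom x)"] val_next[of x] by simp
  then show ?thesis
    unfolding braid3.conj_by_def by (metis braid3.inv_solve_right' braid3.m_closed val_closed)
qed

lemma inv_val: "b3_inv (val x) = val (next_atom x) \<cdot> b3_inv \<delta>"
proof -
  have "val x \<cdot> (val (next_atom x) \<cdot> b3_inv \<delta>) = \<one>\<^bsub>B3\<^esub>"
    by (simp add: val_next braid3.m_assoc[symmetric])
  then show ?thesis by (intro braid3.inv_equality braid3.inv_comm[of "val x"]) simp_all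
qed

lemma delta_word: "\<delta> \<cdot> word xs = word (rot xs) \<cdot> \<delta>"
proof (induction xs)
  case (Cons x xs)
  have "\<delta> \<cdot> (val x \<cdot> word xs) = (\<delta> \<cdot> val x) \<cdot> word xs"
    by (simp add: braid3.m_assoc)
  also have "\<dots> = val (next_atom x) \<cdot> (\<delta> \<cdot> word xs)"
    by (simp add: delta_val braid3.m_assoc)
  finally show ?case by (simp add: Cons.IH braid3.m_assoc)
qed simp

text \<open>
  Induction over words in the atoms and their inverses. Admitting \<open>\<sigma>\<^sub>0\<close> as a letter keeps the
  three atoms on the same footing in every application.
\<close>

lemma B3_induct [consumes 1, case_names one atom inv_atom]:
  assumes "g \<in> carrier B3"
    and one: "P \<one>\<^bsub>B3\<^esub>"
    and atom: "\<And>x g. g \<in> carrier B3 \<Longrightarrow> P g \<Longrightarrow> P (val x \<cdot> g)"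
    and inv_atom: "\<And>x g. g \<in> carrier B3 \<Longrightarrow> P g \<Longrightarrow> P (b3_inv (val x) \<cdot> g)"
  shows "P g"
proof -
  obtain w where w: "w \<in> braid_words 3" and g: "g = braid_class 3 w"
    using assms(1) by (rule braid_group_cases)
  have "P (braid_class 3 w)" using w
  proof (induction w)
    case Nil
    then show ?case using one by (simp add: one_braid_group)
  next
    case (Cons l w)
    then have l: "[l] \<in> braid_words 3" and w: "w \<in> braid_words 3"
      using braid_words_Cons by blast+
    have c: "braid_class 3 (l # w) = braid_class 3 [l] \<cdot> braid_class 3 w"
      using l w by (simp add: mult_braid_group)
    have "\<exists>x. braid_class 3 [l] = val x \<or> braid_class 3 [l] = b3_inv (val x)"
    proof (cases l)
      case (Gen i)
      then have "i = 1 \<or> i = 2" using l by auto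
      then show ?thesis using Gen \<sigma>\<^sub>1_def \<sigma>\<^sub>2_def braid_gen_def val.simps by metis
    next
      case (Gen_inv i)
      then have i: "1 \<le> i" "i < 3" using l by auto
      then have "braid_class 3 [Gen_inv i] \<cdot> braid_gen 3 i = \<one>\<^bsub>B3\<^esub>"
        using braid_equiv.cancel[of "Gen_inv i" 3]
        by (simp add: braid_gen_def mult_braid_group one_braid_group braid_class_eq_iff)
      then have "braid_class 3 [Gen_inv i] = b3_inv (braid_gen 3 i)"
        using i by (intro braid3.inv_equality[symmetric]) (simp_all add: braid_gen_def braid_class_closed)
      moreover have "i = 1 \<or> i = 2" using i by auto
      ultimately show ?thesis using Gen_inv \<sigma>\<^sub>1_def \<sigma>\<^sub>2_def val.simps by metis
    qed
    then show ?case using Cons.IH[OF w] w atom inv_atom c by (auto simp: braid_class_closed)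
  qed
  then show ?thesis using g by simp
qed

definition tree :: "atom list set" where
  "tree = {zs. reduced zs}"

definition tree_gen :: "nat \<Rightarrow> atom list \<Rightarrow> atom list" where
  "tree_gen i = restrict (push (if i = 1 then S1 else S2)) tree"

definition act :: "letter list set \<Rightarrow> atom list \<Rightarrow> atom list" where
  "act = braid_lift (BijGroup tree) tree_gen"

lemma tree_gen_Bij: "tree_gen i \<in> Bij tree"
proof -
  have "bij_betw (push x) tree tree" for x
    by (rule bij_betw_byWitness[where f' = "pull x"])
      (auto simp: tree_def push_pull reduced_push reduced_pull)
  then show ?thesis by (auto simp: Bij_def tree_gen_def cong: bij_betw_cong)
qed

text \<open>
  The braid relation holds because \<open>push S2\<close> after \<open>push S1\<close> is the rotation, and the rotation
  conjugates \<open>push S2\<close> into \<open>push S1\<close>.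
\<close>

lemma tree_braid_rep: "braid_rep 3 (BijGroup tree) tree_gen"
proof (intro braid_rep.intro braid_rep_axioms.intro)
  show "group (BijGroup tree)" by (rule group_BijGroup)
  show "tree_gen i \<in> carrier (BijGroup tree)" for i
    using tree_gen_Bij by (simp add: BijGroup_def)
  fix i :: nat assume "1 \<le> i" "i + 1 < 3"
  then have i: "i = 1" by simp
  have eq: "push S1 (push S2 (push S1 zs)) = push S2 (push S1 (push S2 zs))" if "reduced zs" for zs
  proof -
    have "push S1 (push S2 (push S1 zs)) = push S1 (rot zs)"
      using push_push[OF that, of S2] by simp
    also have "\<dots> = rot (push S2 zs)" by (simp add: rot_push)
    also have "\<dots> = push S2 (push S1 (push S2 zs))"
      using push_push[OF reduced_push[OF that], of S2 S2] by simp
    finally show ?thesis .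
  qed
  have "compose tree (tree_gen i) (compose tree (tree_gen (i + 1)) (tree_gen i)) =
      compose tree (tree_gen (i + 1)) (compose tree (tree_gen i) (tree_gen (i + 1)))"
    unfolding compose_def i
    by (intro restrict_ext) (auto simp: tree_gen_def tree_def reduced_push eq)
  then show "tree_gen i \<otimes>\<^bsub>BijGroup tree\<^esub> (tree_gen (i + 1) \<otimes>\<^bsub>BijGroup tree\<^esub> tree_gen i) =
      tree_gen (i + 1) \<otimes>\<^bsub>BijGroup tree\<^esub> (tree_gen i \<otimes>\<^bsub>BijGroup tree\<^esub> tree_gen (i + 1))"
    by (simp add: BijGroup_def tree_gen_Bij compose_Bij)
qed auto

interpretation tree: group_action B3 tree act
  unfolding act_def
  by (intro group_action.intro group_hom.intro group_hom_axioms.intro group_braid_group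
      group_BijGroup braid_rep.braid_lift_hom tree_braid_rep)

lemma act_reduced [simp]: "g \<in> carrier B3 \<Longrightarrow> reduced zs \<Longrightarrow> reduced (act g zs)"
  using tree.element_image[of g zs] by (simp add: tree_def)

lemma act_mult:
  "g \<in> carrier B3 \<Longrightarrow> h \<in> carrier B3 \<Longrightarrow> reduced zs \<Longrightarrow> act (g \<cdot> h) zs = act g (act h zs)"
  using tree.composition_rule[of zs g h] by (simp add: tree_def)

lemma act_one: "reduced zs \<Longrightarrow> act \<one>\<^bsub>B3\<^esub> zs = zs"
  using tree.id_eq_one by (metis mem_Collect_eq restrict_apply' tree_def)

text \<open>
  For \<open>\<sigma>\<^sub>1\<close> and \<open>\<sigma>\<^sub>2\<close> this is how the action was defined; for \<open>\<sigma>\<^sub>0\<close> it follows from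
  \<open>\<sigma>\<^sub>1\<sigma>\<^sub>0 = \<sigma>\<^sub>2\<sigma>\<^sub>1\<close>.
\<close>

lemma act_val:
  assumes "reduced zs"
  shows "act (val x) zs = push x zs"
proof -
  have *: "act (val x) zs = push x zs" if "x \<noteq> S0" "reduced zs" for x zs
  proof (cases x)
    case S1
    then show ?thesis
      using braid_rep.braid_lift_gen[OF tree_braid_rep, of 1] that
      by (simp add: act_def \<sigma>\<^sub>1_def tree_gen_def tree_def)
  next
    case S2
    then show ?thesis
      using braid_rep.braid_lift_gen[OF tree_braid_rep, of 2] that
      by (simp add: act_def \<sigma>\<^sub>2_def tree_gen_def tree_def)
  qed (use that in auto)
  have "push S1 (act (val S0) zs) = act (val S1 \<cdot> val S0) zs"
    using assms act_mult[of "val S1" "val S0" zs] *[of S1 "act (val S0) zs"] by simp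
  also have "val S1 \<cdot> val S0 = val S2 \<cdot> val S1"
    using val_next[of S1] val_next[of S2] by simp
  also have "act (val S2 \<cdot> val S1) zs = push S2 (push S1 zs)"
    using assms by (simp only: act_mult reduced_push * val_closed) (simp add: * reduced_push del: val.simps)
  also have "\<dots> = push S1 (push S0 zs)"
    using push_push[OF assms, of S1] push_push[OF assms, of S2] by simp
  finally have "act (val S0) zs = push S0 zs"
    using push_pull(2)[of "act (val S0) zs" S1] push_pull(2)[of "push S0 zs" S1] assms
    by (metis act_reduced reduced_push val_closed)
  then show ?thesis using * assms by (cases "x = S0") auto
qed

lemma act_inv_val:
  assumes "reduced zs"
  shows "act (b3_inv (val x)) zs = pull x zs"
proof -
  have "push x (act (b3_inv (val x)) zs) = act (val x \<cdot> b3_inv (val x)) zs"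
    using assms act_mult[of "val x" "b3_inv (val x)" zs] by (simp only: act_val act_reduced val_closed braid3.inv_closed)
  then have "push x (act (b3_inv (val x)) zs) = zs" using assms by (simp add: act_one)
  then show ?thesis using push_pull(2)[of "act (b3_inv (val x)) zs" x] assms by simp
qed

lemma act_delta:
  assumes "reduced zs"
  shows "act \<delta> zs = rot zs"
proof -
  have "act \<delta> zs = act (val S2) (act (val S1) zs)"
    using assms by (simp add: \<delta>_def act_mult)
  also have "\<dots> = push S2 (push S1 zs)"
    using assms by (simp only: act_val reduced_push)
  finally show ?thesis using push_push[OF assms, of S2] by simp
qed

lemma act_inv_delta:
  assumes "reduced zs"
  shows "act (b3_inv \<delta>) zs = rot' zs"
proof -
  have "act (b3_inv \<delta> \<cdot> \<delta>) (rot' zs) = act (b3_inv \<delta>) (rot (rot' zs))"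
    using assms act_mult[of "b3_inv \<delta>" \<delta> "rot' zs"] by (simp only: act_delta reduced_rot delta_closed braid3.inv_closed)
  then show ?thesis using assms by (simp add: act_one o_def)
qed

lemma tdist_act:
  assumes "g \<in> carrier B3" "reduced xs" "reduced ys"
  shows "tdist (act g xs) (act g ys) = tdist xs ys"
  using assms
proof (induction g arbitrary: xs ys rule: B3_induct)
  case one
  then show ?case by (simp add: act_one)
next
  case (atom x g)
  then show ?case by (simp add: act_mult act_val tdist_push)
next
  case (inv_atom x g)
  have "tdist (push x (pull x as)) (push x (pull x bs)) = tdist (pull x as) (pull x bs)"
    if "reduced as" "reduced bs" for as bs
    using that by (intro tdist_push reduced_pull)
  then show ?case using inv_atom by (simp add: act_mult act_inv_val push_pull)
qed

section \<open>Length and Gromov product\<close>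

text \<open>
  The image of the root determines \<open>g\<close> up to a right factor in \<open>\<langle>\<delta>\<rangle>\<close>: \<open>nf g\<close> is the Garside normal
  form for the dual presentation with the power of \<open>\<delta>\<close> left out. Accordingly \<open>gp g h\<close> is the Gromov
  product, at the root, of its images under \<open>g\<close> and \<open>h\<close>.
\<close>

definition nf :: "letter list set \<Rightarrow> atom list" where
  "nf g = act g []"

definition len :: "letter list set \<Rightarrow> nat" where
  "len g = length (nf g)"

definition gp :: "letter list set \<Rightarrow> letter list set \<Rightarrow> nat" where
  "gp g h = common (nf g) (nf h)"

lemma reduced_nf [simp]: "g \<in> carrier B3 \<Longrightarrow> reduced (nf g)"
  by (simp add: nf_def)

lemma nf_mult: "g \<in> carrier B3 \<Longrightarrow> h \<in> carrier B3 \<Longrightarrow> nf (g \<cdot> h) = act g (nf h)"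
  by (simp add: nf_def act_mult)

lemma nf_one [simp]: "nf \<one>\<^bsub>B3\<^esub> = []"
  by (simp add: nf_def act_one)

lemma len_one [simp]: "len \<one>\<^bsub>B3\<^esub> = 0"
  by (simp add: len_def)

lemma gp_commute: "gp g h = gp h g"
  by (simp add: gp_def common_commute)

lemma gp_ultra: "min (gp g h) (gp h k) \<le> gp g k"
  by (simp add: gp_def common_ultra)

lemma gp_self [simp]: "gp g g = len g"
  by (simp add: gp_def len_def)

text \<open>
  Both sides compute the distance between the images of the root under \<open>g\<close> and \<open>h\<close>, since
  \<open>g\<^sup>-\<^sup>1\<close> moves them to the root and its image under \<open>g\<^sup>-\<^sup>1h\<close>.
\<close>

lemma len_inv_mult:
  assumes "g \<in> carrier B3" "h \<in> carrier B3"
  shows "len (b3_inv g \<cdot> h) + 2 * gp g h = len g + len h"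
proof -
  have "g \<cdot> (b3_inv g \<cdot> h) = (g \<cdot> b3_inv g) \<cdot> h"
    using assms by (simp only: braid3.m_assoc braid3.inv_closed)
  then have "nf h = act g (nf (b3_inv g \<cdot> h))"
    using assms nf_mult[of g "b3_inv g \<cdot> h"] by simp
  then have "tdist (nf g) (nf h) = tdist [] (nf (b3_inv g \<cdot> h))"
    using assms tdist_act[of g "[]" "nf (b3_inv g \<cdot> h)"] by (simp add: nf_def)
  then show ?thesis by (simp add: tdist_def len_def gp_def)
qed

lemma len_inv [simp]:
  assumes "g \<in> carrier B3"
  shows "len (b3_inv g) = len g"
  using len_inv_mult[OF assms, of "\<one>\<^bsub>B3\<^esub>"] assms by (simp add: gp_def)

lemma len_mult:
  assumes "g \<in> carrier B3" "h \<in> carrier B3"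
  shows "len (g \<cdot> h) + 2 * gp (b3_inv g) h = len g + len h"
  using len_inv_mult[of "b3_inv g" h] assms by simp

lemma len_conj_delta [simp]:
  assumes "g \<in> carrier B3"
  shows "len (braid3.conj_by \<delta> g) = len g" "len (braid3.conj_by (b3_inv \<delta>) g) = len g"
  using assms
  by (simp_all add: len_def braid3.conj_by_def nf_mult act_mult act_delta act_inv_delta)
    (simp_all add: nf_def act_delta act_inv_delta)

text \<open>
  Let \<open>V\<close> begin and end with inverse halves around one middle letter, and suppose that more than
  half of \<open>U\<close> cancels against \<open>V\<close> in \<open>U V\<close>. If \<open>U\<close> is shorter than \<open>V\<close>, the cancelled part lies in
  the first half of \<open>V\<close> or contains it, so the same happens at the other end of \<open>V\<close>, and conjugation
  cancels more than it adds. The proof needs only that Gromov products are 0-hyperbolic.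
\<close>

lemma conj_shortens:
  assumes "U \<in> carrier B3" "V \<in> carrier B3"
    and "odd (len U)" "len V = Suc (2 * gp V (b3_inv V))" "len U < len V"
    and "len U < 2 * gp (b3_inv U) V"
  shows "len (braid3.conj_by U V) < len V"
proof -
  let ?\<alpha> = "gp (b3_inv U) V" and ?\<beta> = "gp (b3_inv U) (b3_inv V)"
  let ?\<gamma> = "gp (b3_inv (U \<cdot> V)) (b3_inv U)" and ?\<rho> = "gp (b3_inv (U \<cdot> V)) (b3_inv V)"
  have uv: "len (U \<cdot> V) + 2 * ?\<alpha> = len U + len V"
    using assms by (intro len_mult)
  have uvu: "len (braid3.conj_by U V) + 2 * ?\<gamma> = len (U \<cdot> V) + len U"
    using len_mult[of "U \<cdot> V" "b3_inv U"] assms by (simp add: braid3.conj_by_def)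
  have "b3_inv (b3_inv (U \<cdot> V)) \<cdot> b3_inv V = U"
    using assms by (simp add: braid3.m_assoc)
  then have rho: "len U + 2 * ?\<rho> = len (U \<cdot> V) + len V"
    using len_inv_mult[of "b3_inv (U \<cdot> V)" "b3_inv V"] assms by simp
  have "min ?\<alpha> (gp V (b3_inv V)) \<le> ?\<beta>" by (rule gp_ultra)
  moreover have "min ?\<rho> ?\<beta> \<le> ?\<gamma>"
    using gp_ultra[of "b3_inv (U \<cdot> V)" "b3_inv V" "b3_inv U"] by (simp add: gp_commute)
  \<comment> \<open>Together these give \<open>\<alpha> + \<gamma> > |U|\<close>. Parity matters when \<open>\<beta>\<close> is only known to be at least
     \<open>(|V| - 1) / 2\<close>: since both lengths are odd, \<open>|V| - 1 > |U|\<close>.\<close>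
  ultimately show ?thesis using uv uvu rho assms(3-6) by (auto simp: min_def elim!: oddE split: if_splits)
qed

lemma act_word:
  "reduced (xs @ zs) \<Longrightarrow> act (word xs) zs = xs @ zs"
proof (induction xs)
  case (Cons x xs)
  then have "reduced (xs @ zs)" by (auto simp: reduced_Cons)
  moreover have "push x (xs @ zs) = x # xs @ zs"
    using Cons.prems by (intro push_cons) (auto simp: reduced_Cons)
  ultimately show ?case
    using Cons.IH reduced_append by (simp add: act_mult act_val)
qed (simp add: act_one)

lemma nf_word: "reduced xs \<Longrightarrow> nf (word xs) = xs"
  using act_word[of xs "[]"] by (simp add: nf_def)

lemma nf_val [simp]: "nf (val x) = [x]"
  using nf_word[of "[x]"] by simp

lemma len_val [simp]: "len (val x) = 1"
  by (simp add: len_def)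

lemma nf_inv_val: "nf (b3_inv (val x)) = [next_atom x]"
  by (simp add: nf_def act_inv_val pull_cons)

section \<open>Conjugates of the standard generator\<close>

text \<open>
  A conjugate \<open>Q x Q\<^sup>-\<^sup>1\<close> is unchanged if the last letter \<open>u\<close> of \<open>Q\<close> is dropped and \<open>x\<close> replaced by
  \<open>u x u\<^sup>-\<^sup>1\<close>, which is again an atom when \<open>x\<close> is \<open>u\<close> or \<open>next_atom u\<close>. The condition on \<open>last Q\<close>
  says that the remaining case holds, so that \<open>Q\<close> cannot be shortened.
\<close>

definition normal_conj :: "atom list \<Rightarrow> atom \<Rightarrow> bool" where
  "normal_conj Q x \<longleftrightarrow> reduced Q \<and> (Q \<noteq> [] \<longrightarrow> last Q = next_atom x)"

abbreviation conj_of :: "atom list \<Rightarrow> atom \<Rightarrow> letter list set" where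
  "conj_of Q x \<equiv> braid3.conj_by (word Q) (val x)"

lemma conj_inv_delta_conj_of:
  "braid3.conj_by (b3_inv \<delta>) (conj_of Q x) = conj_of (rot' Q) (next_atom (next_atom x))"
proof -
  have eq: "\<delta> \<cdot> word (rot' Q) = word Q \<cdot> \<delta>"
    using delta_word[of "rot' Q"] by (simp add: o_def)
  have "braid3.conj_by \<delta> (conj_of (rot' Q) (next_atom (next_atom x))) =
      braid3.conj_by (\<delta> \<cdot> word (rot' Q)) (val (next_atom (next_atom x)))"
    by (simp add: braid3.conj_by_mult)
  also have "\<dots> = conj_of Q x"
    by (simp add: eq braid3.conj_by_mult conj_delta_val)
  finally show ?thesis
    using braid3.conj_by_inv(2)[of \<delta> "conj_of (rot' Q) (next_atom (next_atom x))"] by simp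
qed

text \<open>
  If \<open>z\<close> is cancelled by the first letter of \<open>Q\<close>, the resulting \<open>\<delta>\<close> passes through the rest of \<open>Q\<close>
  and is absorbed by the central atom, rotating everything on its way; otherwise \<open>Q\<close> grows by
  one letter.
\<close>

lemma conj_atom_conj_of:
  assumes "normal_conj Q x"
  shows "\<exists>R y. normal_conj R y \<and> braid3.conj_by (val z) (conj_of Q x) = conj_of R y"
proof (cases Q)
  case Nil
  consider "x = z" | "x = next_atom z" | "z = next_atom x"
    by (cases x; cases z) auto
  then show ?thesis
  proof cases
    case 1
    then have "braid3.conj_by (val z) (conj_of Q x) = conj_of [] x"
      using Nil by (simp add: braid3.conj_by_def braid3.m_assoc)
    then show ?thesis by (metis list.distinct(1) normal_conj_def reduced_simps(1))
  next
    case 2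
    then have "braid3.conj_by (val z) (conj_of Q x) = conj_of [] (next_atom (next_atom z))"
      using Nil conj_val_next[of z] by (simp add: braid3.conj_by_def)
    then show ?thesis by (metis list.distinct(1) normal_conj_def reduced_simps(1))
  next
    case 3
    then show ?thesis using Nil
      by (intro exI[of _ "[z]"] exI[of _ x]) (simp add: normal_conj_def braid3.conj_by_def)
  qed
next
  case (Cons q Q')
  have mult: "braid3.conj_by (val z) (conj_of Q x) = conj_of (z # Q) x"
    by (simp add: braid3.conj_by_mult)
  show ?thesis
  proof (cases "q = next_atom z")
    case True
    have "word (z # Q) = \<delta> \<cdot> word Q'"
      using Cons True by (simp add: val_next flip: braid3.m_assoc)
    then have "word (z # Q) = word (rot Q') \<cdot> \<delta>" by (simp only: delta_word)
    then have "conj_of (z # Q) x = conj_of (rot Q') (next_atom x)"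
      by (simp only: braid3.conj_by_mult word_closed delta_closed val_closed conj_delta_val)
    moreover have "normal_conj (rot Q') (next_atom x)"
      using assms Cons by (auto simp: normal_conj_def reduced_Cons last_map split: if_splits)
    ultimately show ?thesis using mult by metis
  next
    case False
    then have "normal_conj (z # Q) x"
      using assms Cons by (simp add: normal_conj_def)
    then show ?thesis using mult by metis
  qed
qed

lemma conjugate_normal_form:
  assumes "conjugate B3 X \<sigma>\<^sub>1"
  obtains Q x where "normal_conj Q x" "X = conj_of Q x"
proof -
  obtain g where g: "g \<in> carrier B3" and X: "X = braid3.conj_by g \<sigma>\<^sub>1"
    using assms by (auto simp: conjugate_def braid3.conj_by_def)
  have "\<exists>Q x. normal_conj Q x \<and> braid3.conj_by g \<sigma>\<^sub>1 = conj_of Q x"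
    using g
  proof (induction rule: B3_induct)
    case one
    show ?case
      by (intro exI[of _ "[]"] exI[of _ S1]) (simp add: normal_conj_def)
  next
    case (atom z g)
    then show ?case
      using conj_atom_conj_of by (metis braid3.conj_by_mult sigma_closed(1) val_closed)
  next
    case (inv_atom z g)
    then obtain Q x where Qx: "normal_conj Q x" "braid3.conj_by g \<sigma>\<^sub>1 = conj_of Q x" by blast
    have "braid3.conj_by (b3_inv (val z) \<cdot> g) \<sigma>\<^sub>1 =
        braid3.conj_by (val (next_atom z)) (braid3.conj_by (b3_inv \<delta>) (conj_of Q x))"
      using inv_atom.hyps Qx by (simp add: inv_val braid3.conj_by_mult)
    also have "\<dots> = braid3.conj_by (val (next_atom z)) (conj_of (rot' Q) (next_atom (next_atom x)))"
      by (simp only: conj_inv_delta_conj_of)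
    finally show ?case
      using conj_atom_conj_of[of "rot' Q" "next_atom (next_atom x)" "next_atom z"] Qx(1)
      by (auto simp: normal_conj_def last_map)
  qed
  then show ?thesis using X that by blast
qed

text \<open>
  The first letter is what is needed to see that no cancellation takes place in
  \<open>Q x Q\<^sup>-\<^sup>1\<close>; it is known because the inverse of an atom \<open>u\<close> starts a path with \<open>next_atom u\<close>.
\<close>

lemma nf_inv_word:
  assumes "reduced Q"
  shows "length (nf (b3_inv (word Q))) = length Q \<and>
    (Q \<noteq> [] \<longrightarrow> hd (nf (b3_inv (word Q))) = next_atom (last Q))"
  using assms
proof (induction Q rule: rev_induct)
  case (snoc u Q)
  let ?z = "nf (b3_inv (word Q))"
  have IH: "length ?z = length Q" "Q \<noteq> [] \<longrightarrow> hd ?z = next_atom (last Q)" "Q \<noteq> [] \<longrightarrow> u \<noteq> next_atom (last Q)"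
    using snoc by (auto simp: reduced_append)
  have "b3_inv (word (Q @ [u])) = b3_inv (val u) \<cdot> b3_inv (word Q)"
    by (simp add: word_append braid3.inv_mult_group)
  then have "nf (b3_inv (word (Q @ [u]))) = pull u ?z"
    by (simp add: nf_mult act_inv_val)
  also have "\<dots> = next_atom u # rot' ?z"
    using IH by (intro pull_cons) auto
  finally show ?case using IH by simp
qed simp

text \<open>
  A conjugate and its inverse follow the same path \<open>Q\<close> and then turn in different directions. In
  the inverse, the letter after \<open>Q\<close> repeats the last letter of \<open>Q\<close>.
\<close>

lemma nf_conj_of:
  assumes "normal_conj Q x"
  shows "nf (conj_of Q x) = Q @ x # nf (b3_inv (word Q))"
    and "nf (b3_inv (conj_of Q x)) = Q @ next_atom x # rot' (nf (b3_inv (word Q)))"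
proof -
  let ?z = "nf (b3_inv (word Q))"
  have Q: "reduced Q" "Q \<noteq> [] \<longrightarrow> last Q = next_atom x" using assms by (auto simp: normal_conj_def)
  note z = nf_inv_word[OF Q(1)]
  have hd: "?z = [] \<or> hd ?z = next_atom (next_atom x)" using z Q by (cases "Q = []") auto
  have "nf (conj_of Q x) = act (word Q) (push x ?z)"
    by (simp add: braid3.conj_by_def nf_mult act_mult act_val)
  also have "push x ?z = x # ?z" using hd by (intro push_cons) auto
  also have "act (word Q) (x # ?z) = Q @ x # ?z"
    using Q hd by (intro act_word) (auto simp: reduced_append reduced_Cons)
  finally show "nf (conj_of Q x) = Q @ x # ?z" .
  have "b3_inv (conj_of Q x) = word Q \<cdot> (b3_inv (val x) \<cdot> b3_inv (word Q))"
    by (simp add: braid3.conj_by_def braid3.inv_mult_group braid3.m_assoc)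
  then have "nf (b3_inv (conj_of Q x)) = act (word Q) (pull x ?z)"
    by (simp add: nf_mult act_mult act_inv_val reduced_pull)
  also have "pull x ?z = next_atom x # rot' ?z" using hd by (intro pull_cons) auto
  also have "act (word Q) (next_atom x # rot' ?z) = Q @ next_atom x # rot' ?z"
    using Q hd by (intro act_word) (auto simp: reduced_append reduced_Cons hd_map)
  finally show "nf (b3_inv (conj_of Q x)) = Q @ next_atom x # rot' ?z" .
qed

lemma len_conj_of: "normal_conj Q x \<Longrightarrow> len (conj_of Q x) = Suc (2 * length Q)"
  using nf_inv_word[of Q] by (simp add: len_def nf_conj_of normal_conj_def)

lemma conjugate_closed:
  assumes "conjugate B3 X \<sigma>\<^sub>1"
  shows "X \<in> carrier B3"
  using assms by (auto simp: conjugate_def)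

lemma conjugate_len:
  assumes "conjugate B3 X \<sigma>\<^sub>1"
  shows "odd (len X)" "len X = Suc (2 * gp X (b3_inv X))"
proof -
  obtain Q x where Q: "normal_conj Q x" "X = conj_of Q x" using assms by (rule conjugate_normal_form)
  show "len X = Suc (2 * gp X (b3_inv X))"
    using Q by (simp add: len_conj_of gp_def nf_conj_of common_append)
  then show "odd (len X)" by simp
qed

lemma conjugate_len_one:
  assumes "conjugate B3 X \<sigma>\<^sub>1" "len X \<le> 1"
  obtains x where "X = val x"
proof -
  obtain Q x where Q: "normal_conj Q x" "X = conj_of Q x" using assms(1) by (rule conjugate_normal_form)
  then have "Q = []" using assms(2) len_conj_of by simp
  then show ?thesis using Q that by (simp add: braid3.conj_by_def)
qed

text \<open>
  Two conjugates of the same length whose cancellation contains both middle letters would follow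
  the same path \<open>Q\<close> and then the same edge. But by \<open>nf_conj_of\<close> the inverse of one repeats the
  last letter of \<open>Q\<close> while the other does not, so there cannot be a last letter.
\<close>

lemma equal_len_cancel:
  assumes "conjugate B3 X \<sigma>\<^sub>1" "conjugate B3 Y \<sigma>\<^sub>1" "len X = len Y" "len X < 2 * gp (b3_inv X) Y"
  obtains x where "X = val x" "Y = val (next_atom x)"
proof -
  obtain Q x where Q: "normal_conj Q x" "X = conj_of Q x" using assms(1) by (rule conjugate_normal_form)
  obtain R y where R: "normal_conj R y" "Y = conj_of R y" using assms(2) by (rule conjugate_normal_form)
  have l: "length Q = length R" using assms(3) Q R len_conj_of by simp
  have "Suc (length Q) \<le> gp (b3_inv X) Y" using assms(4) Q len_conj_of by simp
  then have "take (Suc (length Q)) (nf (b3_inv X)) = take (Suc (length Q)) (nf Y)"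
    unfolding gp_def by (rule take_common)
  then have eq: "Q = R" "y = next_atom x" using l Q R by (simp_all add: nf_conj_of)
  then have "Q = []" using Q(1) R(1) by (auto simp: normal_conj_def)
  then show ?thesis using eq Q R that by (simp add: braid3.conj_by_def)
qed

section \<open>Shortening tuples\<close>

definition total_len :: "letter list set list \<Rightarrow> nat" where
  "total_len xs = sum_list (map len xs)"

lemma total_len_simps [simp]:
  "total_len [] = 0" "total_len (x # xs) = len x + total_len xs"
  "total_len (xs @ ys) = total_len xs + total_len ys"
  by (simp_all add: total_len_def)

lemma total_len_conj_delta [simp]:
  assumes "set xs \<subseteq> carrier B3"
  shows "total_len (map (braid3.conj_by \<delta>) xs) = total_len xs"
    "total_len (map (braid3.conj_by (b3_inv \<delta>)) xs) = total_len xs"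
  using assms by (induction xs) auto

lemma hurwitz_delta_pairs: "braid3.hurwitz [val u, val (next_atom u)] [val w, val (next_atom w)]"
proof -
  have step: "braid3.hurwitz [val u, val (next_atom u)]
      [val (next_atom (next_atom u)), val (next_atom (next_atom (next_atom u)))]" for u
    using braid3.hurwitz_moves(1)[of "val u" "val (next_atom u)"] by (simp add: conj_val_next)
  consider "w = u" | "w = next_atom u" | "w = next_atom (next_atom u)"
    by (cases u; cases w) auto
  then show ?thesis
  proof cases
    case 1
    then show ?thesis by (auto intro!: braid3.hrefl)
  next
    case 2
    then show ?thesis
      using braid3.htrans[OF step[of u] step[of "next_atom (next_atom u)"]] by simp
  next
    case 3
    then show ?thesis using step[of u] by simp
  qed
qed

text \<open>
  Moving a pair of product \<open>\<delta>\<close> past other factors conjugates these by \<open>\<delta>\<close>, which does not change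
  their lengths. Next to a factor \<open>Z\<close> that is not an atom, the pair can be rewritten so that
  its second member is the atom whose inverse moves the root one step along \<open>Z\<close>'s path;
  conjugating \<open>Z\<close> by this atom shortens it.
\<close>

lemma shorten_by_delta_pair:
  assumes "set as \<subseteq> carrier B3" "set bs \<subseteq> carrier B3"
    and Z: "Z \<in> set (as @ bs)" "conjugate B3 Z \<sigma>\<^sub>1" "1 < len Z"
  obtains ys where "braid3.hurwitz (as @ val u # val (next_atom u) # bs) ys"
    "total_len ys < total_len (as @ val u # val (next_atom u) # bs)"
proof -
  let ?c = "braid3.conj_by (b3_inv \<delta>)"
  let ?cs = "map ?c as @ bs"
  have cs: "set ?cs \<subseteq> carrier B3" using assms by auto
  have h1: "braid3.hurwitz (as @ val u # val (next_atom u) # bs) (val u # val (next_atom u) # ?cs)"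
    using braid3.hurwitz_append[OF braid3.hurwitz_pull_pair[of "val u" "val (next_atom u)" as], of "[]" bs] assms
    by (simp add: val_next)
  obtain Z' where Z': "Z' \<in> set ?cs" "conjugate B3 Z' \<sigma>\<^sub>1" "1 < len Z'"
  proof (cases "Z \<in> set as")
    case True
    have "Z \<in> carrier B3" using Z(2) by (rule conjugate_closed)
    then show ?thesis
      using that[of "?c Z"] True Z by (simp add: braid3.conjugate_conj_by)
  next
    case False
    then show ?thesis using that[of Z] Z by auto
  qed
  then obtain c1 c2 where c: "?cs = c1 @ Z' # c2" by (meson split_list)
  then have cc: "set c1 \<subseteq> carrier B3" "set c2 \<subseteq> carrier B3" "Z' \<in> carrier B3" using cs by auto
  let ?c1 = "map (braid3.conj_by \<delta>) c1"
  have cc1: "set ?c1 \<subseteq> carrier B3" using cc by auto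
  have h2: "braid3.hurwitz (val u # val (next_atom u) # ?cs) (?c1 @ val u # val (next_atom u) # Z' # c2)"
    unfolding c
    using braid3.hurwitz_append[OF braid3.hurwitz_pass_pair[of "val u" "val (next_atom u)" c1], of "[]" "Z' # c2"] cc
    by (simp add: val_next)
  \<comment> \<open>The inverse of \<open>z\<close> moves the root to \<open>[next_atom z] = [q]\<close>, the first vertex on the path of \<open>Z'\<close>.\<close>
  define q where "q = hd (nf Z')"
  define z where "z = next_atom (next_atom q)"
  have h3: "braid3.hurwitz (?c1 @ val u # val (next_atom u) # Z' # c2) (?c1 @ val (next_atom q) # val z # Z' # c2)"
    using braid3.hurwitz_append[OF hurwitz_delta_pairs[of u "next_atom q"] cc1, of "Z' # c2"] cc
    by (simp add: z_def)
  have h4: "braid3.hurwitz (?c1 @ val (next_atom q) # val z # Z' # c2)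
      (?c1 @ val (next_atom q) # braid3.conj_by (val z) Z' # val z # c2)"
    using braid3.hmove[of "?c1 @ [val (next_atom q)]" c2 "val z" Z'] cc cc1 by simp
  have "nf Z' = q # tl (nf Z')" using Z'(3) by (cases "nf Z'") (auto simp: q_def len_def)
  then have "gp (b3_inv (val z)) Z' \<ge> 1"
    by (metis One_nat_def Suc_le_mono common.simps(1) gp_def le0 next_atom_cube nf_inv_val z_def)
  then have short: "len (braid3.conj_by (val z) Z') < len Z'"
    using Z' cc conjugate_len[OF Z'(2)] by (intro conj_shortens) simp_all
  show ?thesis
  proof (rule that)
    show "braid3.hurwitz (as @ val u # val (next_atom u) # bs)
      (?c1 @ val (next_atom q) # braid3.conj_by (val z) Z' # val z # c2)"
      using h1 h2 h3 h4 braid3.htrans by blast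
    have "total_len (as @ bs) = total_len ?cs" using assms by simp
    then have "total_len (as @ bs) = total_len (c1 @ Z' # c2)" unfolding c .
    then show "total_len (?c1 @ val (next_atom q) # braid3.conj_by (val z) Z' # val z # c2)
      < total_len (as @ val u # val (next_atom u) # bs)"
      using short cc by simp
  qed
qed

text \<open>
  The counterpart of Nielsen's lemma on reduced tuples. If neighbours cancel less than half of each
  other, then prepending a factor \<open>X\<close> cancels against the whole product no more than against the
  first factor, because the product starts with more than half of that factor: this first part of
  the conclusion carries the induction. Each factor then contributes at least 1 to the
  length, and the difference \<open>|X| - 1\<close> of the longest factor remains on top of that.
\<close>

lemma len_list_prod_lower:
  assumes "set xs \<subseteq> carrier B3" "xs \<noteq> []" "\<And>Z. Z \<in> set xs \<Longrightarrow> odd (len Z)"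
    and "successively (\<lambda>X Y. 2 * gp (b3_inv X) Y < min (len X) (len Y)) xs"
  shows "len (hd xs) < 2 * gp (hd xs) (list_prod B3 xs) \<and>
    (\<forall>Z\<in>set xs. length xs + len Z \<le> Suc (len (list_prod B3 xs)))"
  using assms
proof (induction xs rule: induct_list012)
  case (2 X)
  then show ?case by (auto elim: oddE)
next
  case (3 X Y zs)
  let ?P = "list_prod B3 (Y # zs)"
  have X: "X \<in> carrier B3" and P: "?P \<in> carrier B3" using "3.prems" by auto
  have IH: "len Y < 2 * gp Y ?P" "\<And>Z. Z \<in> set (Y # zs) \<Longrightarrow> Suc (length zs) + len Z \<le> Suc (len ?P)"
    using "3.IH"(2) "3.prems" by auto
  have odd: "odd (len X)" "odd (len Y)" using "3.prems" by auto
  have XY: "2 * gp (b3_inv X) Y < len X" "2 * gp (b3_inv X) Y < len Y" using "3.prems" by auto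
  have "min (gp (b3_inv X) ?P) (gp Y ?P) \<le> gp (b3_inv X) Y"
    using gp_ultra[of "b3_inv X" ?P Y] by (simp add: gp_commute)
  then have o: "2 * gp (b3_inv X) ?P < len X" "2 * gp (b3_inv X) ?P < len Y"
    using XY IH(1) by (auto simp: min_def split: if_splits)
  have l: "len (X \<cdot> ?P) + 2 * gp (b3_inv X) ?P = len X + len ?P" using X P by (rule len_mult)
  have "b3_inv X \<cdot> (X \<cdot> ?P) = ?P" using X P by (rule braid3.inv_cancel)
  then have "len ?P + 2 * gp X (X \<cdot> ?P) = len X + len (X \<cdot> ?P)"
    using len_inv_mult[of X "X \<cdot> ?P"] X P by simp
  then have "len X < 2 * gp X (X \<cdot> ?P)" using l o by linarith
  moreover have "length (X # Y # zs) + len Z \<le> Suc (len (X \<cdot> ?P))" if "Z \<in> set (X # Y # zs)" for Z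
  proof (cases "Z \<in> set (Y # zs)")
    case True
    then show ?thesis using IH(2)[of Z] l o by simp
  next
    case False
    then have "Z = X" using that by simp
    then show ?thesis using IH(2)[of Y] l o by simp
  qed
  ultimately show ?case by simp
qed simp

lemma not_successivelyE:
  assumes "\<not> successively P xs"
  obtains as x y bs where "xs = as @ x # y # bs" "\<not> P x y"
  using assms
proof (induction P xs arbitrary: thesis rule: successively.induct)
  case (3 P x y xs)
  show ?case
  proof (cases "P x y")
    case True
    then have "\<not> successively P (y # xs)" using "3.prems"(2) by simp
    then show ?thesis
      using "3.IH" "3.prems"(1)[of "x # as" u v bs for as u v bs] by (metis append_Cons)
  next
    case False
    then show ?thesis using "3.prems"(1)[of "[]" x y xs] by simp
  qed
qed auto

lemma shorten_tuple:
  assumes conj: "\<And>x. x \<in> set xs \<Longrightarrow> conjugate B3 x \<sigma>\<^sub>1"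
    and Z: "Z \<in> set xs" "1 < len Z"
    and short: "len (list_prod B3 xs) \<le> length xs"
  obtains ys where "braid3.hurwitz xs ys" "total_len ys < total_len xs"
proof -
  have carr: "set xs \<subseteq> carrier B3" using conj conjugate_closed by auto
  have "\<not> successively (\<lambda>X Y. 2 * gp (b3_inv X) Y < min (len X) (len Y)) xs"
  proof
    assume "successively (\<lambda>X Y. 2 * gp (b3_inv X) Y < min (len X) (len Y)) xs"
    then have "length xs + len Z \<le> Suc (len (list_prod B3 xs))"
      using len_list_prod_lower[OF carr] conjugate_len(1)[OF conj] Z(1) by fastforce
    then show False using short Z(2) by simp
  qed
  then obtain as X Y bs where xs: "xs = as @ X # Y # bs"
    and big: "\<not> 2 * gp (b3_inv X) Y < min (len X) (len Y)"
    by (rule not_successivelyE)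
  have c: "set as \<subseteq> carrier B3" "set bs \<subseteq> carrier B3" "X \<in> carrier B3" "Y \<in> carrier B3"
    using carr xs by auto
  have XY: "conjugate B3 X \<sigma>\<^sub>1" "conjugate B3 Y \<sigma>\<^sub>1" using conj xs by auto
  note lX = conjugate_len[OF XY(1)] and lY = conjugate_len[OF XY(2)]
  have "min (len X) (len Y) \<noteq> 2 * gp (b3_inv X) Y"
    using lX(1) lY(1) by (metis dvd_triv_left min_def)
  then have big': "min (len X) (len Y) < 2 * gp (b3_inv X) Y" using big by linarith
  consider (less) "len X < len Y" | (greater) "len Y < len X" | (eq) "len X = len Y" by linarith
  then show ?thesis
  proof cases
    case less
    have "len (braid3.conj_by X Y) < len Y"
      using less big' c lX lY by (intro conj_shortens) auto
    moreover have "braid3.hurwitz xs (as @ braid3.conj_by X Y # X # bs)"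
      unfolding xs using c by (intro braid3.hmove)
    ultimately show ?thesis using that xs by auto
  next
    case greater
    have "len (braid3.conj_by (b3_inv Y) (b3_inv X)) < len (b3_inv X)"
      using greater big' c lX lY by (intro conj_shortens) (auto simp: gp_commute)
    moreover have "braid3.conj_by (b3_inv Y) (b3_inv X) = b3_inv (braid3.conj_by (b3_inv Y) X)"
      using c by (simp add: braid3.conj_by_def braid3.inv_mult_group braid3.m_assoc)
    ultimately have "len (braid3.conj_by (b3_inv Y) X) < len X" using c by simp
    moreover have "braid3.hurwitz xs (as @ Y # braid3.conj_by (b3_inv Y) X # bs)"
      unfolding xs using c braid3.hurwitz_append[OF braid3.hurwitz_moves(2)[of X Y], of as bs] by simp
    ultimately show ?thesis using that xs by auto
  next
    case eq
    then obtain x where x: "X = val x" "Y = val (next_atom x)"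
      using equal_len_cancel[OF XY] big' by auto
    have "Z \<in> set (as @ bs)" using Z xs x by auto
    then show ?thesis
      using shorten_by_delta_pair[OF c(1,2) _ conj[OF Z(1)] Z(2), of x] that xs x by metis
  qed
qed

text \<open>
  The length hypothesis depends only on the product and on the number of factors, so it persists
  while the tuple is being shortened.
\<close>

lemma hurwitz_to_atoms:
  assumes "\<And>x. x \<in> set xs \<Longrightarrow> conjugate B3 x \<sigma>\<^sub>1" "len (list_prod B3 xs) \<le> length xs"
  shows "\<exists>us. braid3.hurwitz xs (map val us)"
  using assms
proof (induction "total_len xs" arbitrary: xs rule: less_induct)
  case less
  show ?case
  proof (cases "\<exists>Z\<in>set xs. 1 < len Z")
    case True
    then obtain ys where ys: "braid3.hurwitz xs ys" "total_len ys < total_len xs"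
      using shorten_tuple[OF less.prems(1)] less.prems(2) by metis
    have "\<forall>y\<in>set ys. conjugate B3 y \<sigma>\<^sub>1"
      using braid3.hurwitz_conjugate[OF ys(1), of \<sigma>\<^sub>1] less.prems(1) by simp
    then have "\<exists>us. braid3.hurwitz ys (map val us)"
      using less.hyps[OF ys(2)] less.prems(2) braid3.hurwitz_list_prod[OF ys(1)] braid3.hurwitz_length[OF ys(1)]
      by simp
    then show ?thesis using ys(1) braid3.htrans by blast
  next
    case False
    then have "\<forall>x\<in>set xs. \<exists>u. x = val u"
      using conjugate_len_one less.prems(1) by (meson leI)
    then have "\<exists>us. xs = map val us" by (simp add: ex_map_conv)
    then show ?thesis using less.prems(1) conjugate_closed by (auto intro: braid3.hrefl)
  qed
qed

section \<open>Positive words\<close>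

lemma len_list_prod_le:
  "set xs \<subseteq> carrier B3 \<Longrightarrow> len (list_prod B3 xs) \<le> total_len xs"
proof (induction xs)
  case (Cons x xs)
  then show ?case using len_mult[of x "list_prod B3 xs"] by simp
qed simp

lemma total_len_map_val [simp]: "total_len (map val us) = length us"
  by (induction us) auto

lemma delta_pair_to_front:
  assumes "\<not> reduced us"
  obtains vs where "braid3.hurwitz (map val us) (val S2 # val S1 # map val vs)"
    "length us = Suc (Suc (length vs))"
proof -
  obtain as u bs where us: "us = as @ u # next_atom u # bs" using assms by (rule not_reducedE)
  have conj: "map (braid3.conj_by (b3_inv \<delta>)) (map val as) = map val (rot' as)"
    by (simp add: conj_inv_delta_val o_def)
  have "braid3.hurwitz (map val us) (val u # val (next_atom u) # map val (rot' as @ bs))"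
    using braid3.hurwitz_append[OF braid3.hurwitz_pull_pair[of "val u" "val (next_atom u)" "map val as"],
        of "[]" "map val bs"]
    by (simp add: us val_next conj del: map_map)
  moreover have "braid3.hurwitz (val u # val (next_atom u) # map val (rot' as @ bs))
      (val S2 # val S1 # map val (rot' as @ bs))"
    using braid3.hurwitz_append[OF hurwitz_delta_pairs[of u S2], of "[]" "map val (rot' as @ bs)"]
    by (simp del: val.simps map_map map_append)
  ultimately show ?thesis
    using that[of "rot' as @ bs"] us braid3.htrans by auto
qed

text \<open>
  This makes reducedness a property of the product and the number of letters: splitting off
  \<open>\<delta>\<close>, which fixes the root, leaves two letters fewer to move it.
\<close>

lemma reduced_iff_len:
  "reduced us \<longleftrightarrow> len (word us) = length us"
proof (cases "reduced us")
  case False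
  then obtain vs where vs: "braid3.hurwitz (map val us) (val S2 # val S1 # map val vs)"
    "length us = Suc (Suc (length vs))" by (rule delta_pair_to_front)
  have "word us = \<delta> \<cdot> word vs"
    using braid3.hurwitz_list_prod[OF vs(1)]
    by (simp add: word_def \<delta>_def braid3.m_assoc)
  then have "len (word us) = len (word vs)"
    by (simp add: len_def nf_mult act_delta)
  also have "\<dots> \<le> length vs"
    using len_list_prod_le[of "map val vs"] by (simp add: word_def)
  finally show ?thesis using vs False by simp
qed (simp add: len_def nf_word)

lemma positive_words_hurwitz:
  assumes "word us = word vs" "length us = length vs"
  shows "braid3.hurwitz (map val us) (map val vs)"
  using assms
proof (induction "length us" arbitrary: us vs rule: less_induct)
  case less
  show ?case
  proof (cases "reduced us")
    case True
    then have "reduced vs" using less.prems by (simp add: reduced_iff_len)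
    then have "us = vs" using True nf_word less.prems by metis
    then show ?thesis by (simp add: braid3.hrefl)
  next
    case False
    then have F: "\<not> reduced vs" using less.prems by (simp add: reduced_iff_len)
    obtain us' where us': "braid3.hurwitz (map val us) (val S2 # val S1 # map val us')"
      "length us = Suc (Suc (length us'))" using False by (rule delta_pair_to_front)
    obtain vs' where vs': "braid3.hurwitz (map val vs) (val S2 # val S1 # map val vs')"
      "length vs = Suc (Suc (length vs'))" using F by (rule delta_pair_to_front)
    have "\<sigma>\<^sub>2 \<cdot> (\<sigma>\<^sub>1 \<cdot> word us') = \<sigma>\<^sub>2 \<cdot> (\<sigma>\<^sub>1 \<cdot> word vs')"
      using braid3.hurwitz_list_prod[OF us'(1)] braid3.hurwitz_list_prod[OF vs'(1)] less.prems(1)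
      by (simp add: word_def)
    then have "word us' = word vs'" by simp
    then have "braid3.hurwitz (map val us') (map val vs')"
      using less.hyps[of us' vs'] us'(2) vs'(2) less.prems(2) by simp
    then have "braid3.hurwitz (val S2 # val S1 # map val us') (val S2 # val S1 # map val vs')"
      using braid3.hurwitz_append[of "map val us'" "map val vs'" "[val S2, val S1]" "[]"] by simp
    then show ?thesis using us'(1) vs'(1) braid3.hsym braid3.htrans by metis
  qed
qed

text \<open>The exponent sum, which counts the factors of a quasipositive factorization.\<close>

definition expo :: "letter list set \<Rightarrow> int" where
  "expo = braid_lift integer_group (\<lambda>_. 1)"

lemma expo_rep: "braid_rep 3 integer_group (\<lambda>_. 1)"
  by (intro braid_rep.intro braid_rep_axioms.intro) simp_all

interpretation expo: group_hom B3 integer_group expo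
  unfolding expo_def
  by (intro group_hom.intro group_hom_axioms.intro group_braid_group braid_rep.braid_lift_hom expo_rep) simp

lemma expo_conjugate:
  assumes "conjugate B3 X \<sigma>\<^sub>1"
  shows "expo X = 1"
proof -
  have "expo \<sigma>\<^sub>1 = 1"
    using braid_rep.braid_lift_gen[OF expo_rep, of 1] by (simp add: expo_def \<sigma>\<^sub>1_def)
  then show ?thesis
    using assms by (auto simp: conjugate_def)
qed

lemma expo_list_prod:
  assumes "\<And>x. x \<in> set xs \<Longrightarrow> conjugate B3 x \<sigma>\<^sub>1"
  shows "expo (list_prod B3 xs) = int (length xs)"
  using assms
proof (induction xs)
  case (Cons x xs)
  then have "x \<in> carrier B3" "set xs \<subseteq> carrier B3" using conjugate_closed by auto
  then show ?case using Cons by (simp add: expo_conjugate)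
qed simp

lemma conjugate_val: "conjugate B3 (val x) \<sigma>\<^sub>1"
proof -
  have d: "conjugate B3 (val (next_atom y)) \<sigma>\<^sub>1 \<longleftrightarrow> conjugate B3 (val y) \<sigma>\<^sub>1" for y
    using braid3.conjugate_conj_by[of \<delta> "val y" \<sigma>\<^sub>1] by (simp add: conj_delta_val)
  have "conjugate B3 (val S1) \<sigma>\<^sub>1"
    unfolding conjugate_def by (intro bexI[of _ "\<one>\<^bsub>B3\<^esub>"]) simp_all
  then show ?thesis using d[of S1] d[of S2] by (cases x) simp_all
qed

theorem corollary4:
  assumes "X \<in> carrier B3"
    and "BKL_positive X"
    and "quasipositive_factorization X xs"
    and "quasipositive_factorization X ys"
  shows "hurwitz_equivalent B3 xs ys"
proof -
  obtain ws where ws: "set ws \<subseteq> {\<sigma>\<^sub>0, \<sigma>\<^sub>1, \<sigma>\<^sub>2}" "list_prod B3 ws = X"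
    using assms(2) by (auto simp: BKL_positive_def)
  then have "\<forall>w\<in>set ws. \<exists>u. w = val u" by (metis insertE singletonD subsetD val.simps)
  then have "\<exists>us. ws = map val us" by (simp add: ex_map_conv)
  then obtain us where us: "ws = map val us" ..
  have X: "X = word us" using ws us by (simp add: word_def)
  have eX: "expo X = int (length us)"
    using expo_list_prod[of "map val us"] conjugate_val X by (auto simp: word_def)
  have lX: "len X \<le> length us"
    using len_list_prod_le[of "map val us"] X by (simp add: word_def)
  have "braid3.hurwitz zs (map val us)" if "quasipositive_factorization X zs" for zs
  proof -
    have zs: "list_prod B3 zs = X" "\<And>z. z \<in> set zs \<Longrightarrow> conjugate B3 z \<sigma>\<^sub>1"
      using that by (auto simp: quasipositive_factorization_def)
    have len: "length zs = length us" using expo_list_prod[of zs] zs eX by simp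
    then obtain vs where vs: "braid3.hurwitz zs (map val vs)"
      using hurwitz_to_atoms[of zs] zs lX by auto
    have "word vs = word us"
      using braid3.hurwitz_list_prod[OF vs] zs(1) X by (simp add: word_def)
    moreover have "length vs = length us" using braid3.hurwitz_length[OF vs] len by simp
    ultimately show ?thesis using positive_words_hurwitz vs braid3.htrans by blast
  qed
  then have "braid3.hurwitz xs ys" using assms(3,4) braid3.hsym braid3.htrans by blast
  then show ?thesis by (rule braid3.hurwitz_imp_equivalent)
qed

end
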